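(* Let $A$ be a random matrix drawn from $\mathcal{A}^{m\times n}_k$. Let $x'=(x'_1,\dots,x'_n)$ with $0\le x'_i\le 1$ satisfy $A x'\le e^m$, where $e^m$ is the all-ones vector of length $m$, and let $OPT=\sum_i c_i x'_i$, where the weights satisfy $\max_i c_i = 1$ and $c_i\ge \frac{1}{p}$ for all $i$. Then $x'$ can be rounded to $\hat{x}\in\{0,1\}^n$ such that, with probability at least $1-\frac{1}{m}$, \[ \|A\hat{x}\|_\infty \le O\!\left(\frac{\log(mkp\log m/n)+\log\log m}{\log\log(mkp\log m/n+\log m)}\right) \quad\text{and}\quad \sum_i c_i\hat{x}_i\ge \Omega(OPT). \] Moreover such an $\hat{x}$ can be computed in randomized polynomial time.
   Context: $\mathcal{A}^{m\times n}_k$ denotes the family (distribution) of $m\times n$ $0$-$1$ matrices in which each row, independently, has exactly $k$ ones in columns chosen uniformly at random from $\{1,\dots,n\}$ and zeros elsewhere. *)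

theory Defs
  imports
    "HOL-Probability.Probability"
    "HOL-Library.Log_Nat"
    "HOL-Computational_Algebra.Polynomial"
begin

section \<open>Random matrices and roundings\<close>

text \<open>Matrices and vectors are functions on indices from 0, with the dimensions kept explicit.
  A row is determined by its support, a uniformly random \<open>k\<close>-subset of the column indices;
  all entries outside the \<open>m \<times> n\<close> range are zero.\<close>

definition random_matrix :: "nat \<Rightarrow> nat \<Rightarrow> nat \<Rightarrow> (nat \<Rightarrow> nat \<Rightarrow> int) pmf" where
  "random_matrix m n k =
     map_pmf (\<lambda>S i j. if j \<in> S i then 1 else 0)
       (Pi_pmf {..<m} {} (\<lambda>_. pmf_of_set {S. S \<subseteq> {..<n} \<and> card S = k}))"

definition mat_vec :: "nat \<Rightarrow> (nat \<Rightarrow> nat \<Rightarrow> int) \<Rightarrow> (nat \<Rightarrow> real) \<Rightarrow> nat \<Rightarrow> real" where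
  "mat_vec n A x i = (\<Sum>j<n. of_int (A i j) * x j)"

definition inf_norm :: "nat \<Rightarrow> (nat \<Rightarrow> real) \<Rightarrow> real" where
  "inf_norm m v = Max ((\<lambda>i. \<bar>v i\<bar>) ` {..<m})"

definition objective :: "nat \<Rightarrow> (nat \<Rightarrow> real) \<Rightarrow> (nat \<Rightarrow> real) \<Rightarrow> real" where
  "objective n c x = (\<Sum>j<n. c j * x j)"

definition fractional_solution ::
    "nat \<Rightarrow> nat \<Rightarrow> (nat \<Rightarrow> nat \<Rightarrow> int) \<Rightarrow> (nat \<Rightarrow> real) \<Rightarrow> bool" where
  "fractional_solution m n A x \<longleftrightarrow>
     (\<forall>j<n. 0 \<le> x j \<and> x j \<le> 1) \<and> (\<forall>i<m. mat_vec n A x i \<le> 1)"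

definition weights :: "nat \<Rightarrow> real \<Rightarrow> (nat \<Rightarrow> real) \<Rightarrow> bool" where
  "weights n p c \<longleftrightarrow> Max (c ` {..<n}) = 1 \<and> (\<forall>j<n. 1 / p \<le> c j)"

definition congestion :: "nat \<Rightarrow> nat \<Rightarrow> nat \<Rightarrow> real \<Rightarrow> real" where
  "congestion m n k p =
     (ln (real m * real k * p * ln (real m) / real n) + ln (ln (real m))) /
     ln (ln (real m * real k * p * ln (real m) / real n + ln (real m)))"

text \<open>\<open>C\<close> and \<open>\<delta>\<close> are the constants hidden in \<open>O\<close> and \<open>\<Omega>\<close>. As usual for Landau symbols, \<open>O(f)\<close> bounds
  by a multiple of \<open>\<bar>f\<bar>\<close>; the numerator of \<^const>\<open>congestion\<close> is negative if \<open>n\<close> is very large.\<close>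

definition good_rounding ::
    "real \<Rightarrow> real \<Rightarrow> nat \<Rightarrow> nat \<Rightarrow> nat \<Rightarrow> real \<Rightarrow> (nat \<Rightarrow> nat \<Rightarrow> int) \<Rightarrow> (nat \<Rightarrow> real) \<Rightarrow>
     (nat \<Rightarrow> real) \<Rightarrow> (nat \<Rightarrow> real) \<Rightarrow> bool" where
  "good_rounding C \<delta> m n k p A c x y \<longleftrightarrow>
     (\<forall>j<n. y j \<in> {0, 1}) \<and>
     inf_norm m (mat_vec n A y) \<le> C * \<bar>congestion m n k p\<bar> \<and>
     objective n c y \<ge> \<delta> * objective n c x"


section \<open>Randomized polynomial time\<close>

text \<open>The machine model is a random access machine under the logarithmic cost criterion, presented
  as a while language over finitely many named, integer-indexed integer arrays; a scalar is
  an array used only at index 0. Every value computed, array indices included, is charged its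
  bit length, so that cost is polynomially related to Turing machine time. Randomness
  is a list of fair coin flips, read by \<open>Flip\<close>.\<close>

type_synonym store = "string \<Rightarrow> int \<Rightarrow> int"

datatype aexp =
    Num int
  | Get string aexp
  | Plus aexp aexp
  | Minus aexp aexp
  | Times aexp aexp
  | Div aexp aexp

datatype bexp =
    Less aexp aexp
  | Not bexp
  | And bexp bexp

datatype com =
    Skip
  | Put string aexp aexp
  | Flip string
  | Seq com com
  | If bexp com com
  | While bexp com

definition bits :: "int \<Rightarrow> nat" where
  "bits z = nat (bitlen \<bar>z\<bar>) + 1"

primrec aval :: "aexp \<Rightarrow> store \<Rightarrow> int" where
  "aval (Num z) s = z"
| "aval (Get a e) s = s a (aval e s)"
| "aval (Plus e f) s = aval e s + aval f s"
| "aval (Minus e f) s = aval e s - aval f s"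
| "aval (Times e f) s = aval e s * aval f s"
| "aval (Div e f) s = aval e s div aval f s"

primrec acost :: "aexp \<Rightarrow> store \<Rightarrow> nat" where
  "acost (Num z) s = bits z"
| "acost (Get a e) s = acost e s + bits (aval (Get a e) s)"
| "acost (Plus e f) s = acost e s + acost f s + bits (aval (Plus e f) s)"
| "acost (Minus e f) s = acost e s + acost f s + bits (aval (Minus e f) s)"
| "acost (Times e f) s = acost e s + acost f s + bits (aval (Times e f) s)"
| "acost (Div e f) s = acost e s + acost f s + bits (aval (Div e f) s)"

primrec bval :: "bexp \<Rightarrow> store \<Rightarrow> bool" where
  "bval (Less e f) s \<longleftrightarrow> aval e s < aval f s"
| "bval (Not b) s \<longleftrightarrow> \<not> bval b s"
| "bval (And b d) s \<longleftrightarrow> bval b s \<and> bval d s"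

primrec bcost :: "bexp \<Rightarrow> store \<Rightarrow> nat" where
  "bcost (Less e f) s = acost e s + acost f s + 1"
| "bcost (Not b) s = bcost b s + 1"
| "bcost (And b d) s = bcost b s + bcost d s + 1"

definition update :: "store \<Rightarrow> string \<Rightarrow> int \<Rightarrow> int \<Rightarrow> store" where
  "update s a i z = s(a := (s a)(i := z))"

text \<open>\<open>exec P s w t s' w'\<close>: started in store \<open>s\<close> with coins \<open>w\<close>, program \<open>P\<close> halts after time \<open>t\<close> in store
  \<open>s'\<close>, with the coins \<open>w'\<close> left unread. A program that runs out of coins is stuck.\<close>

inductive exec ::
    "com \<Rightarrow> store \<Rightarrow> bool list \<Rightarrow> nat \<Rightarrow> store \<Rightarrow> bool list \<Rightarrow> bool" where
  Skip: "exec Skip s w 1 s w"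
| Put: "exec (Put a e f) s w (acost e s + acost f s + 1) (update s a (aval e s) (aval f s)) w"
| Flip: "exec (Flip a) s (b # w) 1 (update s a 0 (if b then 1 else 0)) w"
| Seq: "exec P s w t s' w' \<Longrightarrow> exec Q s' w' u s'' w'' \<Longrightarrow> exec (Seq P Q) s w (t + u) s'' w''"
| IfTrue: "bval b s \<Longrightarrow> exec P s w t s' w' \<Longrightarrow> exec (If b P Q) s w (bcost b s + 1 + t) s' w'"
| IfFalse: "\<not> bval b s \<Longrightarrow> exec Q s w t s' w' \<Longrightarrow> exec (If b P Q) s w (bcost b s + 1 + t) s' w'"
| WhileFalse: "\<not> bval b s \<Longrightarrow> exec (While b P) s w (bcost b s + 1) s w"
| WhileTrue: "bval b s \<Longrightarrow> exec P s w t s' w' \<Longrightarrow> exec (While b P) s' w' u s'' w'' \<Longrightarrow>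
    exec (While b P) s w (bcost b s + 1 + t + u) s'' w''"

inductive_cases SkipE: "exec Skip s w t s' w'"
  and PutE: "exec (Put a e f) s w t s' w'"
  and FlipE: "exec (Flip a) s w t s' w'"
  and SeqE: "exec (Seq P Q) s w t s' w'"
  and IfE: "exec (If b P Q) s w t s' w'"
  and WhileE: "exec (While b P) s w t s' w'"

lemma exec_deterministic:
  "exec P s w t s' w' \<Longrightarrow> exec P s w u s'' w'' \<Longrightarrow> u = t \<and> s'' = s' \<and> w'' = w'"
proof (induction arbitrary: u s'' w'' rule: exec.induct)
  case Skip
  then show ?case by (rule SkipE) simp
next
  case Put
  then show ?case by (rule PutE) simp
next
  case Flip
  then show ?case by (rule FlipE) simp
next
  case Seq
  from Seq.prems show ?case by (rule SeqE) (auto dest!: Seq.IH)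
next
  case IfTrue
  from IfTrue.prems show ?case by (rule IfE) (use IfTrue.hyps(1) in \<open>auto dest: IfTrue.IH\<close>)
next
  case IfFalse
  from IfFalse.prems show ?case by (rule IfE) (use IfFalse.hyps(1) in \<open>auto dest: IfFalse.IH\<close>)
next
  case WhileFalse
  from WhileFalse.prems show ?case by (rule WhileE) (use WhileFalse.hyps in simp_all)
next
  case WhileTrue
  from WhileTrue.prems show ?case by (rule WhileE) (use WhileTrue.hyps(1) in \<open>auto dest!: WhileTrue.IH\<close>)
qed

definition halts_within :: "com \<Rightarrow> store \<Rightarrow> nat \<Rightarrow> bool" where
  "halts_within P s T \<longleftrightarrow>
     (\<forall>w. length w = T \<longrightarrow> (\<exists>t s' w'. exec P s w t s' w' \<and> t \<le> T))"

definition coin_flips :: "nat \<Rightarrow> bool list pmf" where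
  "coin_flips T = pmf_of_set {w. length w = T}"

text \<open>The algorithm gets \<open>m\<close>, \<open>n\<close>, the matrix in row-major order and the rational vectors \<open>c\<close> and \<open>x\<close>,
  each as an array of numerators and one of denominators. The rest of the store is zero.\<close>

definition input_store ::
    "nat \<Rightarrow> nat \<Rightarrow> (nat \<Rightarrow> nat \<Rightarrow> int) \<Rightarrow> (nat \<Rightarrow> rat) \<Rightarrow> (nat \<Rightarrow> rat) \<Rightarrow> store" where
  "input_store m n A c x a i =
     (if a = ''m'' \<and> i = 0 then int m
      else if a = ''n'' \<and> i = 0 then int n
      else if a = ''A'' \<and> 0 \<le> i \<and> i < int (m * n) then A (nat i div n) (nat i mod n)
      else if a = ''cnum'' \<and> 0 \<le> i \<and> i < int n then fst (quotient_of (c (nat i)))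
      else if a = ''cden'' \<and> 0 \<le> i \<and> i < int n then snd (quotient_of (c (nat i)))
      else if a = ''xnum'' \<and> 0 \<le> i \<and> i < int n then fst (quotient_of (x (nat i)))
      else if a = ''xden'' \<and> 0 \<le> i \<and> i < int n then snd (quotient_of (x (nat i)))
      else 0)"

definition rat_bits :: "rat \<Rightarrow> nat" where
  "rat_bits r = bits (fst (quotient_of r)) + bits (snd (quotient_of r))"

definition input_size :: "nat \<Rightarrow> nat \<Rightarrow> (nat \<Rightarrow> rat) \<Rightarrow> (nat \<Rightarrow> rat) \<Rightarrow> nat" where
  "input_size m n c x = m * n + (\<Sum>j<n. rat_bits (c j) + rat_bits (x j))"

definition output_vector :: "store \<Rightarrow> nat \<Rightarrow> real" where
  "output_vector s j = of_int (s ''y'' (int j))"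

end

theory Submission
  imports Defs
begin

text \<open>The bound holds for every matrix in the support, and the rounding is deterministic. Let
  \<open>z = (x + 1 / k) / 2\<close>, which is feasible, has at least half the value of \<open>x\<close> and has value at least
  \<open>n / (2 p k)\<close>. Hence \<open>m\<close> divided by the value of \<open>z\<close>, which bounds the average degree of a column under
  the weights \<open>c l * z l\<close>, is at most \<open>2 m k p / n\<close>. Rounding \<open>z\<close> at random and dropping
  columns that meet an overloaded row loses only a constant factor already for a load of order
  \<open>ln D / ln (ln D)\<close>, where \<open>D\<close> is that bound, because a column of degree \<open>d\<close> is dropped with probability at most
  \<open>d\<close> times that of overloading one row. The method of conditional expectations, with the dropping built
  into the estimator, makes this a single greedy pass over the columns. If \<open>D < 1 / 2\<close>, only
  empty columns survive, which covers the range where the claimed bound vanishes.\<close>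

section \<open>Rounding by conditional expectations\<close>

text \<open>The constant vector \<open>1 / k\<close> fills every row exactly, since each row has
  \<open>k\<close> ones; averaging it into \<open>x\<close> costs a factor 2 and bounds the value
  from below in terms of \<open>n\<close>, \<open>p\<close> and \<open>k\<close>. A union bound over
  all rows would force loads of order ln m / ln (ln m). Charging an overloaded row only to the
  columns that meet it replaces \<open>m\<close> by \<open>m\<close> over the value, because a row
  carries total weight at most 1. The scale is the first \<open>b\<close> for which
  \<open>2 ^ b\<close> exceeds twice that quotient. It serves both as exponent and as tilt
  \<open>\<beta> = b\<close> of the exponential moments: these are at most \<open>3 ^ b\<close>, the
  cutoff \<open>\<theta>\<close> is below \<open>6 ^ b\<close>, and a load \<open>h\<close> with
  \<open>(1 + b) powr (h - 1) \<le> 6 ^ b\<close> is of order b / ln (1 + b). That the tilt grows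
  with \<open>b\<close> yields the iterated logarithm in the denominator. With 3 in place of e and
  powers of 2 in place of logarithms, the computation is exact on integers, and polynomial time
  becomes a matter of bit lengths.\<close>

definition growth :: "nat \<Rightarrow> real \<Rightarrow> (nat \<Rightarrow> nat \<Rightarrow> real) \<Rightarrow> (nat \<Rightarrow> real) \<Rightarrow> nat \<Rightarrow> real" where
  "growth n \<beta> a v i = (\<Prod>l<n. 1 + \<beta> * (a i l * v l))"

definition tail_weight ::
    "nat \<Rightarrow> (nat \<Rightarrow> nat \<Rightarrow> real) \<Rightarrow> (nat \<Rightarrow> real) \<Rightarrow> nat \<Rightarrow> (nat \<Rightarrow> real) \<Rightarrow> nat \<Rightarrow> real" where
  "tail_weight n a c j v i = (\<Sum>l=j..<n. a i l * c l * v l)"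

text \<open>Conditional expectations: if every coordinate from \<open>j\<close> on is rounded up independently with probability
  \<open>v l\<close>, then \<open>growth\<close> is the expectation of \<open>(1 + \<beta>)\<close> to the power of the load of a row. The rule below
  chooses the value of coordinate \<open>j\<close> that does not decrease the lower bound
  \<open>potential\<close> on \<open>\<theta>\<close> times the final objective.\<close>

definition accepts ::
    "nat \<Rightarrow> nat \<Rightarrow> (nat \<Rightarrow> nat \<Rightarrow> real) \<Rightarrow> (nat \<Rightarrow> real) \<Rightarrow> real \<Rightarrow> real \<Rightarrow> nat \<Rightarrow> (nat \<Rightarrow> real) \<Rightarrow> bool"
  where
  "accepts m n a c \<beta> \<theta> j v \<longleftrightarrow>
     (\<Sum>i<m. a i j * (growth n \<beta> a v i * (c j + \<beta> * tail_weight n a c (Suc j) v i))) \<le> \<theta> * c j"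

primrec rounding ::
    "nat \<Rightarrow> nat \<Rightarrow> (nat \<Rightarrow> nat \<Rightarrow> real) \<Rightarrow> (nat \<Rightarrow> real) \<Rightarrow> real \<Rightarrow> real \<Rightarrow> (nat \<Rightarrow> real) \<Rightarrow> nat \<Rightarrow>
     nat \<Rightarrow> real" where
  "rounding m n a c \<beta> \<theta> z 0 = z"
| "rounding m n a c \<beta> \<theta> z (Suc j) =
     (rounding m n a c \<beta> \<theta> z j)
       (j := if accepts m n a c \<beta> \<theta> j ((rounding m n a c \<beta> \<theta> z j)(j := 0)) then 1 else 0)"

lemma growth_update:
  assumes "j < n"
  shows "growth n \<beta> a (v(j := r)) i = growth n \<beta> a (v(j := 0)) i * (1 + \<beta> * (a i j * r))"
proof -
  have "growth n \<beta> a (v(j := r)) i =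
      (1 + \<beta> * (a i j * r)) * (\<Prod>l\<in>{..<n} - {j}. 1 + \<beta> * (a i l * v l))" for r
    unfolding growth_def using assms
    by (subst prod.remove[of _ j]) auto
  from this[of r] this[of 0] show ?thesis by simp
qed

lemma tail_weight_update:
  assumes "l < j"
  shows "tail_weight n a c j (v(l := r)) i = tail_weight n a c j v i"
  unfolding tail_weight_def using assms by (intro sum.cong) auto

lemma tail_weight_step:
  assumes "j < n"
  shows "tail_weight n a c j v i = a i j * c j * v j + tail_weight n a c (Suc j) v i"
  unfolding tail_weight_def using assms by (simp add: sum.atLeast_Suc_lessThan)

lemma sum_update:
  fixes f :: "nat \<Rightarrow> real"
  assumes "j < n"
  shows "(\<Sum>l<n. f l * (v(j := r)) l) = (\<Sum>l<n. f l * (v(j := 0)) l) + f j * r"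
proof -
  have "(\<Sum>l<n. f l * (v(j := r)) l) = f j * r + (\<Sum>l\<in>{..<n} - {j}. f l * v l)" for r
    using assms by (subst sum.remove[of _ j]) auto
  from this[of r] this[of 0] show ?thesis by simp
qed

section \<open>The potential argument for the greedy rounding\<close>

locale packing =
  fixes m n :: nat and a :: "nat \<Rightarrow> nat \<Rightarrow> real" and c z :: "nat \<Rightarrow> real" and \<beta> \<theta> :: real
  assumes entries: "i < m \<Longrightarrow> l < n \<Longrightarrow> a i l = 0 \<or> a i l = 1"
    and weight_pos: "l < n \<Longrightarrow> 0 < c l"
    and fractional: "l < n \<Longrightarrow> 0 \<le> z l" "l < n \<Longrightarrow> z l \<le> 1"
    and \<beta>_nonneg: "0 \<le> \<beta>" and \<theta>_pos: "0 < \<theta>"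
begin

abbreviation "y \<equiv> rounding m n a c \<beta> \<theta> z"

lemma entry_nonneg: "i < m \<Longrightarrow> l < n \<Longrightarrow> 0 \<le> a i l"
  using entries by force

lemma y_later: "j \<le> l \<Longrightarrow> y j l = z l"
  by (induction j) auto

lemma y_earlier: "l < j \<Longrightarrow> y j l \<in> {0, 1}"
  by (induction j) (auto simp: less_Suc_eq)

lemma y_range:
  assumes "l < n"
  shows "0 \<le> y j l" "y j l \<le> 1"
  using y_later[of j l] y_earlier[of l j] fractional[OF assms] by (cases "l < j"; force)+

lemma growth_ge_1:
  assumes "i < m" and "\<And>l. l < n \<Longrightarrow> 0 \<le> v l"
  shows "1 \<le> growth n \<beta> a v i"
  unfolding growth_def using assms entry_nonneg \<beta>_nonneg by (intro prod_ge_1) simp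

lemma tail_weight_nonneg:
  assumes "i < m" and "\<And>l. l < n \<Longrightarrow> 0 \<le> v l"
  shows "0 \<le> tail_weight n a c j v i"
  unfolding tail_weight_def using assms entry_nonneg weight_pos
  by (intro sum_nonneg mult_nonneg_nonneg) (auto intro: less_imp_le)

text \<open>An undecided column \<open>l\<close> is charged \<open>c l * v l\<close> for every row
  that it meets, at the rate \<open>growth / \<theta>\<close>, a Markov bound on the probability of
  overloading that row; all is multiplied by \<open>\<theta>\<close>. At \<open>j = n\<close> no
  column is undecided and only the objective remains.\<close>

definition potential :: "nat \<Rightarrow> real" where
  "potential j = \<theta> * (\<Sum>l<n. c l * y j l) -
     (\<Sum>i<m. growth n \<beta> a (y j) i * tail_weight n a c j (y j) i)"

text \<open>The old potential is at most an affine function of \<open>t = z j\<close> with slope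
  \<open>\<theta> * c j - S1 - S2\<close>. \<open>S2\<close> is the increase that column
  \<open>j\<close> causes in the charges of later columns, \<open>S1\<close> the charge on column
  \<open>j\<close> itself, which disappears once the column is decided. \<open>accepts\<close> tests
  the sign of this slope, so moving \<open>t\<close> to the chosen endpoint loses nothing.\<close>

lemma potential_step:
  assumes "j < n"
  shows "potential j \<le> potential (Suc j)"
proof -
  define v where "v = (y j)(j := 0)"
  define t where "t = z j"
  define r :: real where "r = (if accepts m n a c \<beta> \<theta> j v then 1 else 0)"
  define E where "E i = growth n \<beta> a v i" for i
  define W where "W i = tail_weight n a c (Suc j) v i" for i
  have t: "0 \<le> t" "t \<le> 1" using fractional assms by (auto simp: t_def)
  have v_nonneg: "0 \<le> v l" if "l < n" for l
    using y_range[OF that] by (simp add: v_def)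
  have E: "0 \<le> E i" if "i < m" for i
    using order_trans[OF zero_le_one growth_ge_1[of i v]] that v_nonneg unfolding E_def by blast
  have W: "0 \<le> W i" if "i < m" for i
    using tail_weight_nonneg[of i v] that v_nonneg unfolding W_def by blast
  have old: "y j = v(j := t)" by (auto simp: v_def t_def y_later)
  have new: "y (Suc j) = v(j := r)" by (simp add: v_def r_def)
  have vv: "v(j := 0) = v" by (simp add: v_def)
  have g: "growth n \<beta> a (v(j := s)) i = E i * (1 + \<beta> * (a i j * s))" for s i
    using growth_update[OF assms, of \<beta> a v s i] by (simp add: vv E_def)
  have w: "tail_weight n a c (Suc j) (v(j := s)) i = W i" for s i
    by (simp add: tail_weight_update W_def)
  have w': "tail_weight n a c j (v(j := s)) i = a i j * c j * s + W i" for s i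
    using tail_weight_step[OF assms, of a c "v(j := s)" i] w[of s i] by simp
  have o: "(\<Sum>l<n. c l * (v(j := s)) l) = (\<Sum>l<n. c l * v l) + c j * s" for s
    using sum_update[OF assms, of c v s] by (simp add: vv)
  define S1 where "S1 = (\<Sum>i<m. a i j * (E i * c j))"
  define S2 where "S2 = (\<Sum>i<m. a i j * (E i * (\<beta> * W i)))"
  have S1: "0 \<le> S1" unfolding S1_def
    using E entry_nonneg assms weight_pos[OF assms] by (intro sum_nonneg mult_nonneg_nonneg) auto
  have S2: "0 \<le> S2" unfolding S2_def
    using E W entry_nonneg assms \<beta>_nonneg by (intro sum_nonneg mult_nonneg_nonneg) auto
  have acc: "accepts m n a c \<beta> \<theta> j v \<longleftrightarrow> S1 + S2 \<le> \<theta> * c j"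
    unfolding accepts_def S1_def S2_def E_def W_def by (simp add: algebra_simps sum.distrib)
  have pot_new: "potential (Suc j) = \<theta> * (\<Sum>l<n. c l * v l) + \<theta> * c j * r - (\<Sum>i<m. E i * W i) - r * S2"
    unfolding potential_def new g w o S2_def
    by (simp add: algebra_simps sum.distrib sum_distrib_left)
  \<comment> \<open>The product consists of the terms below and one more that is quadratic in
    \<open>t\<close>; the latter is nonnegative and is dropped.\<close>
  have "(\<Sum>i<m. E i * (1 + \<beta> * (a i j * t)) * (a i j * c j * t + W i))
      \<ge> (\<Sum>i<m. E i * W i + t * (a i j * (E i * (\<beta> * W i))) + t * (a i j * (E i * c j)))"
  proof (rule sum_mono)
    fix i assume "i \<in> {..<m}"
    then have i: "i < m" by simp
    have "0 \<le> E i * (\<beta> * (a i j * t)) * (a i j * c j * t)"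
      using E[OF i] \<beta>_nonneg entry_nonneg[OF i assms] t weight_pos[OF assms]
      by (intro mult_nonneg_nonneg) auto
    then show "E i * W i + t * (a i j * (E i * (\<beta> * W i))) + t * (a i j * (E i * c j))
        \<le> E i * (1 + \<beta> * (a i j * t)) * (a i j * c j * t + W i)"
      by (simp add: algebra_simps)
  qed
  also have "(\<Sum>i<m. E i * W i + t * (a i j * (E i * (\<beta> * W i))) + t * (a i j * (E i * c j)))
      = (\<Sum>i<m. E i * W i) + t * S2 + t * S1"
    unfolding S1_def S2_def by (simp add: sum.distrib sum_distrib_left)
  finally have pot_old:
    "potential j \<le> \<theta> * (\<Sum>l<n. c l * v l) + \<theta> * c j * t - (\<Sum>i<m. E i * W i) - t * S2 - t * S1"
    unfolding potential_def old g w' o by (simp add: algebra_simps)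
  show ?thesis
  proof (cases "accepts m n a c \<beta> \<theta> j v")
    case True
    then have "0 \<le> (1 - t) * (\<theta> * c j - S2 - S1)" using acc t by (intro mult_nonneg_nonneg) auto
    moreover have "r = 1" using True by (simp add: r_def)
    ultimately show ?thesis using pot_old pot_new S1 by (simp add: algebra_simps)
  next
    case False
    then have "0 \<le> t * (S1 + S2 - \<theta> * c j)" using acc t by (intro mult_nonneg_nonneg) auto
    moreover have "r = 0" using False by (simp add: r_def)
    ultimately show ?thesis using pot_old pot_new by (simp add: algebra_simps)
  qed
qed

lemma rounding_objective:
  "\<theta> * (\<Sum>l<n. c l * z l) - (\<Sum>i<m. growth n \<beta> a z i * tail_weight n a c 0 z i)
     \<le> \<theta> * (\<Sum>l<n. c l * y n l)"
proof -
  have "j \<le> n \<Longrightarrow> potential 0 \<le> potential j" for j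
    by (induction j) (use potential_step in \<open>auto intro: order_trans\<close>)
  from this[of n] show ?thesis by (simp add: potential_def tail_weight_def)
qed

text \<open>The acceptance sum has nonnegative terms, so the term of row \<open>i\<close> alone is
  at most \<open>\<theta> * c j\<close>, and it contains
  \<open>growth n \<beta> a v i * c j\<close>. The weight cancels: acceptance thus enforces that no
  row met by the column is overloaded, whatever \<open>c j\<close> is.\<close>

lemma accepted_growth:
  assumes i: "i < m" and j: "j < n" and aij: "a i j = 1" and v: "\<And>l. l < n \<Longrightarrow> 0 \<le> v l"
    and acc: "accepts m n a c \<beta> \<theta> j v"
  shows "growth n \<beta> a v i \<le> \<theta>"
proof -
  define f where "f i = a i j * (growth n \<beta> a v i * (c j + \<beta> * tail_weight n a c (Suc j) v i))" for i
  have g: "0 \<le> growth n \<beta> a v i" if "i < m" for i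
    using order_trans[OF zero_le_one growth_ge_1[of i v]] that v by blast
  have tw: "0 \<le> \<beta> * tail_weight n a c (Suc j) v i" if "i < m" for i
    using mult_nonneg_nonneg[OF \<beta>_nonneg tail_weight_nonneg[of i v]] that v by blast
  have "0 \<le> f i" if "i < m" for i
    unfolding f_def using that j g tw weight_pos entry_nonneg by (intro mult_nonneg_nonneg) (auto simp: add_nonneg_nonneg less_imp_le)
  then have "f i \<le> (\<Sum>i<m. f i)" using i by (intro member_le_sum) auto
  then have "f i \<le> \<theta> * c j" using acc by (simp add: accepts_def f_def)
  moreover have "growth n \<beta> a v i * c j \<le> f i"
    unfolding f_def aij using g[OF i] tw[OF i] by (simp add: mult_left_mono)
  ultimately show ?thesis using weight_pos[OF j] by (meson mult_le_cancel_right_pos order_trans)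
qed

text \<open>For decided columns the value is 0 or 1, where \<open>1 + \<beta> * r\<close> and
  \<open>(1 + \<beta>) powr r\<close> agree; the factors of the undecided columns are at least
  1.\<close>

lemma growth_ge_power:
  assumes i: "i < m" and j: "j < n"
  shows "(1 + \<beta>) powr (\<Sum>l<j. a i l * y j l) \<le> growth n \<beta> a ((y j)(j := 0)) i"
proof -
  have p: "(1 + \<beta>) powr (a i l * y j l) = 1 + \<beta> * (a i l * y j l)" if "l < j" for l
    using entries[OF i, of l] y_earlier[OF that] that j \<beta>_nonneg by auto
  have "(1 + \<beta>) powr (\<Sum>l<j. a i l * y j l) = (\<Prod>l<j. (1 + \<beta>) powr (a i l * y j l))"
    using \<beta>_nonneg by (simp add: powr_sum)
  also have "\<dots> = (\<Prod>l<j. 1 + \<beta> * (a i l * y j l))" by (intro prod.cong) (auto simp: p)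
  also have "\<dots> = (\<Prod>l<j. 1 + \<beta> * (a i l * ((y j)(j := 0)) l))" by (intro prod.cong) auto
  also have "\<dots> \<le> (\<Prod>l<n. 1 + \<beta> * (a i l * ((y j)(j := 0)) l))"
    using i j entry_nonneg[OF i] y_range \<beta>_nonneg
    by (intro prod_mono2) (auto simp: add_nonneg_nonneg)
  finally show ?thesis by (simp add: growth_def)
qed

text \<open>The exponent is the load minus 1 because acceptance controls the load just before the
  last accepted column of the row is added. The alternative 0 belongs to rows that no accepted
  column meets; nothing compares them with \<open>\<theta>\<close>, which may be below 1.\<close>

lemma rounding_load:
  assumes i: "i < m"
  shows "(\<Sum>l<n. a i l * y n l) = 0 \<or> (1 + \<beta>) powr ((\<Sum>l<n. a i l * y n l) - 1) \<le> \<theta>"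
proof -
  have "(\<Sum>l<j. a i l * y j l) = 0 \<or> (1 + \<beta>) powr ((\<Sum>l<j. a i l * y j l) - 1) \<le> \<theta>" if "j \<le> n" for j
    using that
  proof (induction j)
    case (Suc j)
    then have j: "j < n" by simp
    define v where "v = (y j)(j := 0)"
    have v: "0 \<le> v l" if "l < n" for l using y_range[OF that] by (simp add: v_def)
    have prefix: "(\<Sum>l<j. a i l * y (Suc j) l) = (\<Sum>l<j. a i l * y j l)"
      by (intro sum.cong) auto
    show ?case
    proof (cases "a i j = 1 \<and> accepts m n a c \<beta> \<theta> j v")
      case True
      then have "growth n \<beta> a v i \<le> \<theta>" using accepted_growth[of i j v] i j v by blast
      with growth_ge_power[OF i j] have "(1 + \<beta>) powr (\<Sum>l<j. a i l * y j l) \<le> \<theta>"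
        by (simp add: v_def)
      moreover have "(\<Sum>l<Suc j. a i l * y (Suc j) l) - 1 = (\<Sum>l<j. a i l * y j l)"
        using True prefix by (simp add: v_def)
      ultimately show ?thesis by metis
    next
      case False
      then have "a i j * y (Suc j) j = 0" using entries[OF i j] by (auto simp: v_def)
      then have "(\<Sum>l<Suc j. a i l * y (Suc j) l) = (\<Sum>l<j. a i l * y j l)"
        using prefix by simp
      with Suc.IH Suc.prems show ?thesis by (metis Suc_leD)
    qed
  qed simp
  then show ?thesis by blast
qed

end

section \<open>Comparison with the congestion bound\<close>

text \<open>The fraction is chosen so that \<open>4 * (17 / 25)\<close> equals
  \<open>272 / 100\<close>, the available upper bound on e.\<close>

lemma ln_2_ge: "17 / 25 \<le> ln (2::real)"
proof -
  have "exp (1::real) ^ 17 \<le> (272 / 100) ^ 17"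
    using e_less_272 by (intro power_mono) auto
  also have "\<dots> \<le> 2 ^ 25" by (simp add: power_divide)
  finally have "exp (17::real) \<le> 2 ^ 25" by (simp flip: exp_of_nat_mult)
  then have "17 \<le> ln ((2::real) ^ 25)" by (simp add: ln_ge_iff)
  then have "17 \<le> 25 * ln (2::real)" by (subst (asm) ln_realpow) auto
  then show ?thesis by simp
qed

text \<open>16 is the first integer above \<open>exp (exp 1)\<close>. From there on the term
  \<open>ln (ln m)\<close> is at least 1 and can absorb additive constants.\<close>

lemma ln_ln_ge_1:
  assumes "16 \<le> m"
  shows "exp 1 \<le> ln (real m)" and "1 \<le> ln (ln (real m))"
proof -
  have "exp 1 \<le> 4 * ln (2::real)" using ln_2_ge e_less_272 by simp
  also have "\<dots> = ln (2 ^ 4)" by (subst ln_realpow) auto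
  also have "\<dots> \<le> ln (real m)" using assms by simp
  finally show "exp 1 \<le> ln (real m)" .
  then show "1 \<le> ln (ln (real m))"
    using less_le_trans[OF exp_gt_zero] by (subst ln_ge_iff) auto
qed

text \<open>A quotient-free form of the fact that a / ln a is increasing up to constants. If
  \<open>s \<le> a ^ 2\<close>, then \<open>ln s\<close> is at most twice \<open>ln a\<close>;
  otherwise \<open>a\<close> is below \<open>sqrt s\<close>, and
  \<open>ln s \<le> 2 * sqrt s\<close> suffices.\<close>

lemma ratio_ln_ge:
  fixes s a :: real
  assumes "1 < s" and "2 \<le> a" and "a \<le> 4 * s"
  shows "a * ln s \<le> 8 * s * ln a"
proof (cases "s \<le> a ^ 2")
  case True
  then have "ln s \<le> ln (a ^ 2)" using assms by simp
  then have "ln s \<le> 2 * ln a" using assms by (simp add: ln_realpow)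
  then have "a * ln s \<le> a * (2 * ln a)" using assms by simp
  also have "\<dots> \<le> 4 * s * (2 * ln a)" using assms by (intro mult_right_mono) auto
  finally show ?thesis by simp
next
  case False
  define r where "r = sqrt s"
  have r: "r * r = s" "0 < r" using assms by (auto simp: r_def)
  have "a \<le> r" using False assms unfolding r_def by (simp add: real_le_rsqrt)
  have "ln s = 2 * ln r" using r by (simp flip: r(1) add: ln_mult)
  also have "\<dots> \<le> 2 * r" using ln_le_minus_one[OF r(2)] by simp
  finally have "a * ln s \<le> r * (2 * r)" using \<open>a \<le> r\<close> assms r
    by (intro mult_mono) auto
  also have "\<dots> = 2 * s" using r by simp
  also have "\<dots> \<le> 8 * s * ln a"
  proof -
    have "ln 2 \<le> ln a" using assms by simp
    then have "2 \<le> 8 * ln a" using ln_2_ge by simp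
    then have "2 * s \<le> (8 * ln a) * s" using assms by (intro mult_right_mono) auto
    then show ?thesis by (simp add: ac_simps)
  qed
  finally show ?thesis .
qed

text \<open>The denominator of \<open>congestion\<close> is \<open>ln s\<close>, so the target has
  order s / ln s, while \<open>load\<close> bounds \<open>h\<close> by the order of a / ln a, and
  \<open>u\<close> makes \<open>a\<close> at most \<open>4 * s\<close>. The constant is 240 = 3 * 8
  * 10: 3 for solving \<open>load\<close> for \<open>h\<close>, 8 from \<open>ratio_ln_ge\<close>,
  10 for comparing \<open>s\<close> with the numerator.\<close>

lemma load_le_congestion:
  fixes b :: nat and h p :: real
  assumes m: "16 \<le> m" and b: "1 \<le> b" and u: "2 ^ b \<le> 8 * (real m * real k * p / real n)"
    and load: "(1 + real b) powr (h - 1) \<le> 6 ^ b"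
  shows "h \<le> 240 * congestion m n k p"
proof -
  define u where "u = real m * real k * p / real n"
  define L where "L = ln (real m)"
  define s where "s = ln (L * (u + 1))"
  define a where "a = real b + 1"
  have L: "1 \<le> ln L" "0 < L" using ln_ln_ge_1[OF m] by (auto simp: L_def intro: less_le_trans[OF exp_gt_zero])
  have u_ge: "2 ^ b \<le> 8 * u" using u by (simp add: u_def)
  have "(2::real) ^ 1 \<le> 2 ^ b" using b by (intro power_increasing) auto
  \<comment> \<open>\<open>ln u\<close> may be negative, but only by a constant; this keeps the
    numerator of \<open>congestion\<close> away from 0.\<close>
  then have u4: "1 / 4 \<le> u" using u_ge by simp
  have s_eq: "s = ln L + ln (u + 1)" unfolding s_def using L u4 by (intro ln_mult_pos) auto
  have s1: "1 < s" using s_eq L u4 ln_gt_zero[of "u + 1"] by linarith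
  have a2: "2 \<le> a" using b by (simp add: a_def)
  have a4: "a \<le> 4 * s"
  proof (cases "b \<le> 3")
    case True
    then show ?thesis using s1 by (simp add: a_def)
  next
    case False
    have "ln ((2::real) ^ b) \<le> ln (8 * u)" using u_ge u4 by (subst ln_le_cancel_iff) auto
    also have "ln (8 * u) = 3 * ln 2 + ln u" using u4 ln_realpow[of 2 3] by (simp add: ln_mult)
    finally have "(real b - 3) * ln 2 \<le> ln u" by (simp add: ln_realpow algebra_simps)
    moreover have "(real b - 3) * (1 / 2) \<le> (real b - 3) * ln 2"
      using False ln_2_ge by (intro mult_left_mono) auto
    ultimately have "(real b - 3) / 2 \<le> ln u" by simp
    also have "\<dots> \<le> ln (u + 1)" using u4 by simp
    finally have "1 + (real b - 3) / 2 \<le> s" unfolding s_eq by (intro add_mono L(1))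
    moreover have "3 \<le> real b" using False by simp
    ultimately show ?thesis unfolding a_def by argo
  qed
  \<comment> \<open>Because \<open>u + 1 \<le> 5 * u\<close>, \<open>ln u\<close> falls short of
    \<open>ln (u + 1)\<close> by at most \<open>19 / 10\<close>. The numerator contains
    \<open>ln L\<close> twice and \<open>1 \<le> ln L\<close>, so a tenth of \<open>ln L\<close>
    survives the loss.\<close>
  have num: "s \<le> 10 * (ln (u * L) + ln L)"
  proof -
    have "1 + 19 / 20 + (19 / 20)\<^sup>2 / 2 \<le> exp (19 / 20 :: real)"
      by (rule exp_lower_Taylor_quadratic) simp
    then have "12 / 5 \<le> exp (19 / 20 :: real)" by (simp add: power2_eq_square)
    then have "(12 / 5) * (12 / 5) \<le> exp (19 / 20 :: real) * exp (19 / 20)" by (intro mult_mono) auto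
    then have "5 \<le> exp (19 / 10 :: real)" by (simp flip: exp_add)
    then have "ln 5 \<le> ln (exp (19 / 10 :: real))" by (subst ln_le_cancel_iff) auto
    then have "ln 5 \<le> (19 / 10 :: real)" by simp
    moreover have "ln (u + 1) \<le> ln (5 * u)" using u4 by simp
    moreover have "ln (5 * u) = ln 5 + ln u" using u4 by (simp add: ln_mult)
    moreover have "ln (u * L) = ln u + ln L" using u4 L by (simp add: ln_mult)
    moreover have "0 \<le> ln (u + 1)" using u4 by simp
    ultimately show ?thesis using s_eq L by simp
  qed
  have "(h - 1) * ln a \<le> b * ln 6"
  proof -
    have "ln ((1 + real b) powr (h - 1)) \<le> ln (6 ^ b)" using load b by (subst ln_le_cancel_iff) auto
    then show ?thesis by (simp add: ln_powr ln_realpow a_def add.commute)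
  qed
  also have "b * ln 6 \<le> b * (2::real)"
  proof -
    have "1 + 1 + 1\<^sup>2 / 2 \<le> exp (1 :: real)" by (rule exp_lower_Taylor_quadratic) simp
    then have "(5 / 2) * (5 / 2) \<le> exp (1 :: real) * exp 1" by (intro mult_mono) auto
    then have "6 \<le> exp (2 :: real)" by (simp flip: exp_add)
    then have "ln 6 \<le> ln (exp (2 :: real))" by (subst ln_le_cancel_iff) auto
    then have "ln 6 \<le> (2 :: real)" by simp
    then show ?thesis by (intro mult_left_mono) auto
  qed
  \<comment> \<open>Passing from \<open>h - 1\<close> to \<open>h\<close> costs one
    \<open>ln a\<close>, which is at most \<open>a - 1 = b\<close>.\<close>
  finally have "h * ln a \<le> 3 * a" using ln_le_minus_one[of a] a2
    by (simp add: a_def algebra_simps)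
  moreover have ls: "0 < ln s" using s1 by simp
  ultimately have "h * ln a * ln s \<le> 3 * a * ln s" by (intro mult_right_mono) auto
  also have "\<dots> \<le> 3 * (8 * s * ln a)" using ratio_ln_ge[OF s1 a2 a4] by simp
  finally have "(h * ln s) * ln a \<le> (24 * s) * ln a" by (simp add: ac_simps)
  then have "h * ln s \<le> 24 * s" using a2 by (simp add: mult_le_cancel_right_pos)
  also have "\<dots> \<le> 240 * (ln (u * L) + ln L)" using num by simp
  finally have "h \<le> 240 * (ln (u * L) + ln L) / ln s" using ls by (simp add: pos_le_divide_eq)
  also have "\<dots> = 240 * congestion m n k p"
    unfolding congestion_def s_def u_def L_def by (simp add: field_simps)
  finally show ?thesis .
qed

section \<open>Feasibility, value and load for matrices with \<open>k\<close> ones in each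
  row\<close>

definition zero_one_matrix :: "nat \<Rightarrow> nat \<Rightarrow> nat \<Rightarrow> (nat \<Rightarrow> nat \<Rightarrow> int) \<Rightarrow> bool" where
  "zero_one_matrix m n k A \<longleftrightarrow>
     (\<forall>i<m. (\<forall>l<n. A i l = 0 \<or> A i l = 1) \<and> (\<Sum>l<n. A i l) = int k)"

lemma random_matrix_zero_one:
  assumes "k \<le> n" and "A \<in> set_pmf (random_matrix m n k)"
  shows "zero_one_matrix m n k A"
proof -
  let ?F = "{S. S \<subseteq> {..<n} \<and> card S = k}"
  \<comment> \<open>\<open>k \<le> n\<close> makes the family of supports nonempty, so that
    \<open>pmf_of_set\<close> really is the uniform distribution on it.\<close>
  have "{..<k} \<in> ?F" using assms(1) by auto
  then have F: "?F \<noteq> {}" "finite ?F" by (blast, auto intro: finite_subset[of _ "Pow {..<n}"])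
  from assms(2) obtain S where S: "S \<in> set_pmf (Pi_pmf {..<m} {} (\<lambda>_. pmf_of_set ?F))"
    and A: "A = (\<lambda>i j. if j \<in> S i then 1 else 0)"
    unfolding random_matrix_def by auto
  have "S i \<in> ?F" if "i < m" for i
    using S that F set_Pi_pmf_subset[of "{..<m}" "{}" "\<lambda>_. pmf_of_set ?F"]
    by (auto simp: set_Pi_pmf PiE_dflt_def)
  then have "(\<Sum>l<n. A i l) = int k" if "i < m" for i
    using that by (force simp: A sum.If_cases Int_absorb1)
  then show ?thesis unfolding zero_one_matrix_def A by auto
qed

definition mixed :: "nat \<Rightarrow> (nat \<Rightarrow> real) \<Rightarrow> nat \<Rightarrow> real" where
  "mixed k x l = (x l + 1 / real k) / 2"

text \<open>Each factor obeys \<open>1 + t \<le> exp t\<close>, so the product is at most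
  \<open>exp b\<close>. Replacing e by 3 gives an integer power, which the program can hold
  exactly.\<close>

lemma growth_le:
  assumes "\<And>l. l < n \<Longrightarrow> 0 \<le> a i l * v l" and "(\<Sum>l<n. a i l * v l) \<le> 1"
  shows "growth n (real b) a v i \<le> 3 ^ b"
proof -
  have "growth n (real b) a v i \<le> (\<Prod>l<n. exp (real b * (a i l * v l)))"
    unfolding growth_def using assms(1) by (intro prod_mono) (auto simp: add_nonneg_nonneg)
  also have "\<dots> = exp (real b * (\<Sum>l<n. a i l * v l))"
    by (simp add: exp_sum sum_distrib_left)
  also have "\<dots> \<le> exp (real b * 1)" using mult_left_mono[OF assms(2), of "real b"] by simp
  also have "\<dots> = exp 1 ^ b" by (simp flip: exp_of_nat_mult)
  also have "\<dots> \<le> 3 ^ b" using exp_le by (intro power_mono) auto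
  finally show ?thesis .
qed

lemma weightsD:
  assumes "weights n p c" and "0 < p" and "l < n"
  shows "1 / p \<le> c l" and "0 < c l" and "c l \<le> 1"
proof -
  show "1 / p \<le> c l" using assms by (simp add: weights_def)
  then show "0 < c l" using assms(2) less_le_trans[of 0 "1 / p" "c l"] by simp
  have "c l \<le> Max (c ` {..<n})" using assms(3) by (intro Max_ge) auto
  then show "c l \<le> 1" using assms(1) by (simp add: weights_def)
qed

locale instance_data =
  fixes m n k :: nat and p :: real and A :: "nat \<Rightarrow> nat \<Rightarrow> int" and c x :: "nat \<Rightarrow> real"
  assumes m: "1 \<le> m" and k: "1 \<le> k" "k \<le> n" and p: "0 < p"
    and A: "zero_one_matrix m n k A" and weights: "weights n p c"
    and solution: "fractional_solution m n A x"
begin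

abbreviation "a \<equiv> \<lambda>i l. real_of_int (A i l)"
abbreviation "z \<equiv> mixed k x"

lemma z_range:
  assumes "l < n"
  shows "0 < z l" and "z l \<le> 1"
proof -
  have "0 \<le> x l" "x l \<le> 1" using solution assms by (auto simp: fractional_solution_def)
  moreover have "0 < 1 / real k" "1 / real k \<le> 1" using k by auto
  ultimately have "0 < x l + 1 / real k" "x l + 1 / real k \<le> 2" by linarith+
  then show "0 < z l" "z l \<le> 1" by (auto simp: mixed_def)
qed

lemma entries: "i < m \<Longrightarrow> l < n \<Longrightarrow> a i l = 0 \<or> a i l = 1"
  using A by (force simp: zero_one_matrix_def)

lemma z_rows:
  assumes "i < m"
  shows "(\<Sum>l<n. a i l * z l) \<le> 1"
proof -
  have "(\<Sum>l<n. a i l) = real k"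
    using A assms by (simp add: zero_one_matrix_def flip: of_int_sum)
  moreover have "(\<Sum>l<n. a i l * x l) \<le> 1"
    using solution assms by (simp add: fractional_solution_def mat_vec_def)
  moreover have "(\<Sum>l<n. a i l * z l) = ((\<Sum>l<n. a i l * x l) + (\<Sum>l<n. a i l) / real k) / 2"
    by (simp add: mixed_def sum.distrib sum_divide_distrib distrib_left add_divide_distrib)
  ultimately show ?thesis using k by simp
qed

text \<open>The bounds come from the two halves of \<open>z\<close>: the half of \<open>x\<close>,
  and the half of \<open>1 / k\<close>, whose value is at least \<open>n / (2 * p * k)\<close>
  because all weights are at least \<open>1 / p\<close>.\<close>

lemma objective_z_ge: "objective n c x / 2 \<le> objective n c z" "n / (2 * p * k) \<le> objective n c z"
proof -
  have eq: "objective n c z = objective n c x / 2 + (\<Sum>l<n. c l) / (2 * k)"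
    by (simp add: objective_def mixed_def sum.distrib sum_divide_distrib distrib_left
        add_divide_distrib mult.commute)
  have "(\<Sum>l<n. 1 / p) \<le> (\<Sum>l<n. c l)" using weightsD(1)[OF weights p] by (intro sum_mono) auto
  then have s: "n / p \<le> (\<Sum>l<n. c l)" by simp
  have "0 \<le> objective n c x" unfolding objective_def
    using weightsD(2)[OF weights p] solution
    by (intro sum_nonneg mult_nonneg_nonneg) (auto simp: fractional_solution_def intro: less_imp_le)
  moreover have "n / p / (2 * k) \<le> (\<Sum>l<n. c l) / (2 * k)"
    using s by (intro divide_right_mono) auto
  moreover have "0 \<le> n / p / (2 * k)" using p by simp
  ultimately show "objective n c x / 2 \<le> objective n c z" "n / (2 * p * k) \<le> objective n c z"
    using eq by (auto simp: field_simps)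
qed

lemma objective_z_pos: "0 < objective n c z"
proof -
  have "0 < n / (2 * p * k)" using k p by auto
  then show ?thesis using objective_z_ge(2) by linarith
qed

text \<open>The cutoff at which an initial charge of \<open>3 ^ b\<close> per row amounts to half of
  \<open>threshold b * objective n c z\<close>.\<close>

definition threshold :: "nat \<Rightarrow> real" where
  "threshold b = 2 * 3 ^ b * real m / objective n c z"

lemma packing: "packing m n a c z (real b) (threshold b)"
  using entries z_range weightsD[OF weights p] objective_z_pos m
  by unfold_locales (auto simp: threshold_def less_imp_le)

abbreviation "rounded b \<equiv> rounding m n a c (real b) (threshold b) z n"

text \<open>Weights and row sums of \<open>z\<close> are at most 1, so every row starts with tail at
  most 1 and charge at most \<open>3 ^ b\<close>. Half of the initial objective therefore survives
  in the potential.\<close>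

lemma rounded_objective: "objective n c z / 2 \<le> objective n c (rounded b)"
proof -
  interpret packing m n a c z "real b" "threshold b" by (rule packing)
  have c: "0 \<le> c l" "c l \<le> 1" if "l < n" for l
    using weightsD[OF weights p that] by auto
  have az: "0 \<le> a i l * z l" if "i < m" "l < n" for i l
    using entry_nonneg that z_range by (simp add: less_imp_le)
  have "(\<Sum>i<m. growth n (real b) a z i * tail_weight n a c 0 z i) \<le> (\<Sum>i<m. 3 ^ b * 1)"
  proof (intro sum_mono mult_mono)
    fix i assume "i \<in> {..<m}"
    then have i: "i < m" by simp
    show "growth n (real b) a z i \<le> 3 ^ b" using az i z_rows by (intro growth_le) auto
    have "tail_weight n a c 0 z i = (\<Sum>l<n. c l * (a i l * z l))"
      by (simp add: tail_weight_def ac_simps atLeast0LessThan)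
    also have "\<dots> \<le> (\<Sum>l<n. 1 * (a i l * z l))"
      using c az i by (intro sum_mono mult_right_mono) auto
    also have "\<dots> \<le> 1" using z_rows i by simp
    finally show "tail_weight n a c 0 z i \<le> 1" .
    show "0 \<le> tail_weight n a c 0 z i"
      using i z_range by (intro tail_weight_nonneg) (auto intro: less_imp_le)
  qed auto
  then have "threshold b * objective n c z - 3 ^ b * real m \<le> threshold b * objective n c (rounded b)"
    using rounding_objective by (simp add: objective_def mult.commute)
  moreover have "3 ^ b * real m = threshold b * (objective n c z / 2)"
    using objective_z_pos by (simp add: threshold_def)
  ultimately have "threshold b * (objective n c z / 2) \<le> threshold b * objective n c (rounded b)"
    by (simp add: mult.commute)
  then show ?thesis using \<theta>_pos by (simp add: mult_le_cancel_left_pos)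
qed

text \<open>\<open>above\<close> puts the cutoff below \<open>6 ^ b\<close>, which bounds the load
  in terms of \<open>b\<close>. \<open>below\<close>, combined with the value bound
  \<open>n / (2 * p * k)\<close>, limits \<open>2 ^ b\<close> to \<open>8 * m * k * p / n\<close>,
  the scale of \<open>congestion\<close>.\<close>

lemma rounded_load:
  assumes m16: "16 \<le> m" and i: "i < m"
    and above: "2 * real m < 2 ^ b * objective n c z"
    and below: "b = 0 \<or> 2 ^ (b - 1) * objective n c z \<le> 2 * real m"
  shows "\<bar>mat_vec n A (rounded b) i\<bar> \<le> 240 * \<bar>congestion m n k p\<bar>"
proof -
  interpret packing m n a c z "real b" "threshold b" by (rule packing)
  define h where "h = (\<Sum>l<n. a i l * y n l)"
  have h: "mat_vec n A (rounded b) i = h" by (simp add: mat_vec_def h_def)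
  have "0 \<le> h" unfolding h_def using entry_nonneg i y_range by (intro sum_nonneg mult_nonneg_nonneg) auto
  have thr: "threshold b < 6 ^ b"
  proof -
    have "3 ^ b * (2 * real m) < 3 ^ b * (2 ^ b * objective n c z)" using above by simp
    also have "\<dots> = 6 ^ b * objective n c z" by (simp flip: power_mult_distrib)
    finally show ?thesis using objective_z_pos by (simp add: threshold_def divide_less_eq ac_simps)
  qed
  have "h = 0 \<or> (1 + real b) powr (h - 1) \<le> threshold b"
    using rounding_load[OF i] by (simp add: h_def)
  \<comment> \<open>For \<open>b = 0\<close> the power has base 1 and equals 1, while
    \<open>thr\<close> makes the cutoff smaller than 1; so \<open>h = 0\<close> is forced, and the
    claim holds even if \<open>congestion\<close> vanishes.\<close>
  then consider "h = 0" | "(1 + real b) powr (h - 1) \<le> 6 ^ b" "b \<noteq> 0"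
    using thr by force
  then show ?thesis
  proof cases
    case 1
    then show ?thesis by (simp add: h)
  next
    case 2
    have "2 ^ (b - 1) * (n / (2 * p * k)) \<le> 2 ^ (b - 1) * objective n c z"
      using objective_z_ge(2) by (intro mult_left_mono) auto
    also have "\<dots> \<le> 2 * real m" using below 2 by simp
    finally have "2 ^ (b - 1) \<le> 4 * (real m * real k * p / real n)"
      using k p by (simp add: field_simps)
    then have "2 ^ b \<le> 8 * (real m * real k * p / real n)"
      using 2(2) by (cases b) auto
    then have "h \<le> 240 * congestion m n k p"
      using load_le_congestion[OF m16 _ _ 2(1)] 2(2) by simp
    then show ?thesis using \<open>0 \<le> h\<close> h by simp
  qed
qed

lemma good_rounding_rounded:
  assumes m16: "16 \<le> m"
    and above: "2 * real m < 2 ^ b * objective n c z"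
    and below: "b = 0 \<or> 2 ^ (b - 1) * objective n c z \<le> 2 * real m"
    and y': "\<And>l. l < n \<Longrightarrow> y' l = rounded b l"
  shows "good_rounding 240 (1 / 4) m n k p A c x y'"
proof -
  interpret packing m n a c z "real b" "threshold b" by (rule packing)
  have "mat_vec n A y' = mat_vec n A (rounded b)" by (auto simp: mat_vec_def y')
  moreover have "objective n c y' = objective n c (rounded b)" by (simp add: objective_def y')
  moreover have "inf_norm m (mat_vec n A (rounded b)) \<le> 240 * \<bar>congestion m n k p\<bar>"
    unfolding inf_norm_def using m rounded_load[OF m16 _ above below]
    by (subst Max_le_iff) (auto simp: lessThan_empty_iff)
  ultimately show ?thesis
    using rounded_objective[of b] objective_z_ge(1) y_earlier y'
    by (auto simp: good_rounding_def)
qed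

lemma ex_base:
  "\<exists>b. 2 * real m < 2 ^ b * objective n c z \<and> (b = 0 \<or> 2 ^ (b - 1) * objective n c z \<le> 2 * real m)"
proof -
  let ?P = "\<lambda>b. 2 * real m < 2 ^ b * objective n c z"
  obtain b0 where "2 * real m / objective n c z < 2 ^ b0"
    using real_arch_pow[of 2] by auto
  then have "?P b0" using objective_z_pos by (simp add: divide_less_eq)
  then have "?P (LEAST b. ?P b)" by (rule LeastI)
  moreover have "(LEAST b. ?P b) = 0 \<or> \<not> ?P ((LEAST b. ?P b) - 1)"
    using not_less_Least[of "(LEAST b. ?P b) - 1" ?P] by auto
  ultimately show ?thesis by (intro exI[of _ "LEAST b. ?P b"]) auto
qed

lemma ex_good_rounding: "16 \<le> m \<Longrightarrow> \<exists>y. good_rounding 240 (1 / 4) m n k p A c x y"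
  using ex_base good_rounding_rounded by blast

end

section \<open>Total correctness with time bounds\<close>

text \<open>The coin list is arbitrary and comes back unread. One such statement therefore gives
  halting on all coin lists and success for every outcome of the coins.\<close>

definition runs :: "com \<Rightarrow> store \<Rightarrow> nat \<Rightarrow> (store \<Rightarrow> bool) \<Rightarrow> bool" where
  "runs P s T Q \<longleftrightarrow> (\<exists>t s'. (\<forall>w. exec P s w t s' w) \<and> t \<le> T \<and> Q s')"

lemma runs_mono:
  assumes "runs P s T Q" and "T \<le> T'" and "\<And>s. Q s \<Longrightarrow> Q' s"
  shows "runs P s T' Q'"
  using assms unfolding runs_def by (meson le_trans)

lemma runs_Skip: "Q s \<Longrightarrow> 1 \<le> T \<Longrightarrow> runs Skip s T Q"
  unfolding runs_def by (meson exec.Skip)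

lemma runs_Put:
  assumes "Q (update s a (aval e s) (aval f s))" and "acost e s + acost f s + 1 \<le> T"
  shows "runs (Put a e f) s T Q"
  using assms unfolding runs_def by (meson exec.Put)

lemma runs_Seq:
  assumes "runs P s T (\<lambda>s'. runs R s' T' Q)"
  shows "runs (Seq P R) s (T + T') Q"
proof -
  from assms obtain t s' where P: "\<And>w. exec P s w t s' w" "t \<le> T" "runs R s' T' Q"
    unfolding runs_def by blast
  then obtain t' s'' where R: "\<And>w. exec R s' w t' s'' w" "t' \<le> T'" "Q s''"
    unfolding runs_def by blast
  have "exec (Seq P R) s w (t + t') s'' w" for w by (rule exec.Seq[OF P(1) R(1)])
  then show ?thesis unfolding runs_def using P R by (intro exI[of _ "t + t'"] exI[of _ s'']) auto
qed

lemma runs_If: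
  assumes "bval b s \<Longrightarrow> runs P s T Q" and "\<not> bval b s \<Longrightarrow> runs R s T Q"
  shows "runs (If b P R) s (bcost b s + 1 + T) Q"
proof (cases "bval b s")
  case True
  with assms obtain t s' where "\<And>w. exec P s w t s' w" "t \<le> T" "Q s'"
    unfolding runs_def by blast
  with True show ?thesis unfolding runs_def
    by (intro exI[of _ "bcost b s + 1 + t"] exI[of _ s'] conjI allI exec.IfTrue) auto
next
  case False
  with assms obtain t s' where "\<And>w. exec R s w t s' w" "t \<le> T" "Q s'"
    unfolding runs_def by blast
  with False show ?thesis unfolding runs_def
    by (intro exI[of _ "bcost b s + 1 + t"] exI[of _ s'] conjI allI exec.IfFalse) auto
qed

text \<open>The invariant is indexed by the number of completed rounds, so \<open>N\<close> is the
  exact number of iterations. The induction is on the remaining rounds, which peels rounds off the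
  front of the loop.\<close>

lemma runs_While:
  assumes "I 0 s"
    and step: "\<And>i s. i < N \<Longrightarrow> I i s \<Longrightarrow> bval b s \<and> runs P s T (I (Suc i))"
    and exit: "\<And>s. I N s \<Longrightarrow> \<not> bval b s"
    and cost: "\<And>i s. i \<le> N \<Longrightarrow> I i s \<Longrightarrow> bcost b s \<le> D"
  shows "runs (While b P) s (N * (D + 1 + T) + (D + 1)) (I N)"
proof -
  have "runs (While b P) s (r * (D + 1 + T) + (D + 1)) (I N)" if "I (N - r) s" "r \<le> N" for r s
    using that
  proof (induction r arbitrary: s)
    case 0
    have "exec (While b P) s w (bcost b s + 1) s w" for w
      using exit 0 by (intro exec.WhileFalse) auto
    with 0 cost[of N s] show ?case unfolding runs_def
      by (intro exI[of _ "bcost b s + 1"] exI[of _ s]) auto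
  next
    case (Suc r)
    then have i: "N - Suc r < N" "Suc (N - Suc r) = N - r" by auto
    from step[OF i(1) Suc.prems(1)] i(2) have b: "bval b s" and P: "runs P s T (I (N - r))" by auto
    from P obtain t s' where P: "\<And>w. exec P s w t s' w" "t \<le> T" "I (N - r) s'"
      unfolding runs_def by blast
    from Suc.IH[OF P(3)] Suc.prems obtain u s'' where
      W: "\<And>w. exec (While b P) s' w u s'' w" "u \<le> r * (D + 1 + T) + (D + 1)" "I N s''"
      unfolding runs_def by auto
    have "exec (While b P) s w (bcost b s + 1 + t + u) s'' w" for w
      by (rule exec.WhileTrue[OF b P(1) W(1)])
    moreover have "bcost b s \<le> D" using cost[OF _ Suc.prems(1)] by simp
    then have "bcost b s + 1 + t + u \<le> Suc r * (D + 1 + T) + (D + 1)" using P W by simp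
    ultimately show ?case using W(3) unfolding runs_def by blast
  qed
  from this[of N] assms(1) show ?thesis by simp
qed

section \<open>Bit lengths and the cost of expressions\<close>

text \<open>A single bound for all cells makes the cost of an expression depend on its syntax and
  \<open>B\<close> only; timing the program then reduces to counting assignments and guards.\<close>

definition store_bounded :: "nat \<Rightarrow> store \<Rightarrow> bool" where
  "store_bounded B s \<longleftrightarrow> (\<forall>a i. \<bar>s a i\<bar> \<le> 2 ^ B)"

text \<open>A constant weighs its bit length, since that is what evaluating it costs. All other
  nodes weigh 1, which makes the size a bound on the bit length of the value in units of
  \<open>B + 2\<close>.\<close>

primrec esize :: "aexp \<Rightarrow> nat" where
  "esize (Num z) = bits z"
| "esize (Get a e) = esize e + 1"
| "esize (Plus e f) = esize e + esize f + 1"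
| "esize (Minus e f) = esize e + esize f + 1"
| "esize (Times e f) = esize e + esize f + 1"
| "esize (Div e f) = esize e + esize f + 1"

lemma bits_le_iff: "bits z \<le> Suc d \<longleftrightarrow> \<bar>z\<bar> < 2 ^ d"
  unfolding bits_def using bitlen_le_iff_power[of "\<bar>z\<bar>" "int d"] bitlen_nonneg[of "\<bar>z\<bar>"]
  by (cases "z = 0") (auto simp: nat_le_iff bitlen_def)

lemma bits_pos: "1 \<le> bits z"
  by (simp add: bits_def)

lemma abs_less_bits: "\<bar>z\<bar> < 2 ^ (bits z - 1)"
  using bits_le_iff[of z "bits z - 1"] bits_pos[of z] by simp

text \<open>The extra unit in \<open>bits\<close> absorbs the carry: for bit counts
  \<open>d + 1\<close> and \<open>e + 1\<close> the sum stays below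
  \<open>2 ^ (d + e + 1)\<close>.\<close>

lemma bits_add: "bits (x + y) \<le> bits x + bits y"
proof -
  obtain d e where d: "bits x = Suc d" and e: "bits y = Suc e"
    using bits_pos by (metis Suc_le_D One_nat_def)
  then have "\<bar>x\<bar> < 2 ^ d" "\<bar>y\<bar> < 2 ^ e" by (metis bits_le_iff order_refl)+
  moreover have "(2::int) ^ d \<le> 2 ^ (d + e)" "(2::int) ^ e \<le> 2 ^ (d + e)"
    by (auto intro: power_increasing)
  ultimately have "\<bar>x + y\<bar> < 2 ^ (d + e) + 2 ^ (d + e)"
    using abs_triangle_ineq[of x y] by linarith
  then have "\<bar>x + y\<bar> < 2 ^ Suc (d + e)" by simp
  then show ?thesis unfolding d e using bits_le_iff[of "x + y" "Suc (d + e)"] by simp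
qed

lemma bits_minus: "bits (- y) = bits y"
  by (simp add: bits_def)

lemma bits_mult: "bits (x * y) \<le> bits x + bits y"
proof -
  obtain d e where d: "bits x = Suc d" and e: "bits y = Suc e"
    using bits_pos by (metis Suc_le_D One_nat_def)
  then have "\<bar>x\<bar> < 2 ^ d" "\<bar>y\<bar> < 2 ^ e" by (metis bits_le_iff order_refl)+
  then have "\<bar>x\<bar> * \<bar>y\<bar> < 2 ^ d * 2 ^ e" by (intro mult_strict_mono) auto
  then have "bits (x * y) \<le> Suc (d + e)" by (simp add: bits_le_iff abs_mult power_add)
  then show ?thesis by (simp add: d e)
qed

text \<open>Floor division never leaves the range of the dividend. A negative divisor is reduced to
  a positive one by changing both signs, and division by 0 yields 0.\<close>

lemma abs_div_le_abs: "\<bar>x div y\<bar> \<le> \<bar>x\<bar>" for x y :: int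
proof -
  have pos: "\<bar>x div y\<bar> \<le> \<bar>x\<bar>" if "0 < y" for x y :: int
    using that zdiv_mono2[of x 1 y] zdiv_mono2_neg[of x 1 y] div_neg_pos_less0[of x y]
      pos_imp_zdiv_nonneg_iff[of y x] by (cases "0 \<le> x") auto
  show ?thesis using pos[of y x] pos[of "- y" "- x"] by (cases y "0 :: int" rule: linorder_cases) auto
qed

lemma bits_div: "bits (x div y) \<le> bits x + bits y"
proof -
  have "\<bar>x div y\<bar> < 2 ^ (bits x - 1)" using abs_div_le_abs[of x y] abs_less_bits[of x] by simp
  then have "bits (x div y) \<le> Suc (bits x - 1)" by (simp only: bits_le_iff)
  then show ?thesis using bits_pos[of x] by simp
qed

lemma bits_bounded: "store_bounded B s \<Longrightarrow> bits (s a i) \<le> B + 2"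
proof -
  assume "store_bounded B s"
  then have "\<bar>s a i\<bar> \<le> 2 ^ B" by (simp add: store_bounded_def)
  also have "\<dots> < 2 ^ Suc B" by simp
  finally show ?thesis using bits_le_iff[of "s a i" "Suc B"] by simp
qed

lemma bits_aval:
  assumes "store_bounded B s"
  shows "bits (aval e s) \<le> esize e * (B + 2)"
proof (induction e)
  case (Num z)
  then show ?case by simp
next
  case (Get a e)
  then show ?case using bits_bounded[OF assms, of a "aval e s"] by (simp add: algebra_simps)
next
  case (Plus e f)
  then show ?case using bits_add[of "aval e s" "aval f s"] by (simp add: algebra_simps)
next
  case (Minus e f)
  then show ?case using bits_add[of "aval e s" "- aval f s"]
    by (simp add: algebra_simps bits_minus)
next
  case (Times e f)
  then show ?case using bits_mult[of "aval e s" "aval f s"] by (simp add: algebra_simps)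
next
  case (Div e f)
  then show ?case using bits_div[of "aval e s" "aval f s"] by (simp add: algebra_simps)
qed

text \<open>The induction step for quadratic cost: the squares of the sizes \<open>p\<close> and
  \<open>q\<close> of the subterms, together with the linear charge for the value of the node, fit
  into the square of the whole size.\<close>

lemma acost_node:
  fixes p q d x y b :: nat
  assumes "x \<le> p\<^sup>2 * d" and "y \<le> q\<^sup>2 * d" and "b \<le> (p + q + 1) * d"
  shows "x + y + b \<le> (p + q + 1)\<^sup>2 * d"
proof -
  have "x + y + b \<le> (p\<^sup>2 + q\<^sup>2 + (p + q + 1)) * d" using assms by (simp add: algebra_simps)
  also have "\<dots> \<le> (p + q + 1)\<^sup>2 * d"
    by (intro mult_right_mono) (auto simp: power2_eq_square algebra_simps)
  finally show ?thesis .
qed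

lemma acost_le:
  assumes "store_bounded B s"
  shows "acost e s \<le> (esize e)\<^sup>2 * (B + 2)"
proof (induction e)
  case (Num z)
  have "bits z * 1 \<le> bits z * bits z * 1" using bits_pos[of z] by (simp only: mult_1_right) simp
  also have "bits z * bits z * 1 \<le> bits z * bits z * (B + 2)" by (intro mult_left_mono) auto
  finally show ?case by (simp add: power2_eq_square)
next
  case (Get a e)
  then show ?case using acost_node[of _ "esize e" "B + 2" 0 0] bits_aval[OF assms, of "Get a e"] by simp
next
  case (Plus e f)
  show ?case
    unfolding acost.simps esize.simps
    by (rule acost_node[OF Plus bits_aval[OF assms, of "Plus e f", unfolded esize.simps]])
next
  case (Minus e f)
  show ?case
    unfolding acost.simps esize.simps
    by (rule acost_node[OF Minus bits_aval[OF assms, of "Minus e f", unfolded esize.simps]])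
next
  case (Times e f)
  show ?case
    unfolding acost.simps esize.simps
    by (rule acost_node[OF Times bits_aval[OF assms, of "Times e f", unfolded esize.simps]])
next
  case (Div e f)
  show ?case
    unfolding acost.simps esize.simps
    by (rule acost_node[OF Div bits_aval[OF assms, of "Div e f", unfolded esize.simps]])
qed

text \<open>The allowance for one assignment or one guard. The factor 1000 covers the squared sizes
  of all expressions of the program; the largest is the update of \<open>H\<close>, of size
  27.\<close>

definition tick :: "nat \<Rightarrow> nat" where
  "tick B = 1000 * (B + 2)"

lemma update_apply [simp]: "update s a i z b l = (if b = a \<and> l = i then z else s b l)"
  by (simp add: update_def)

lemma store_bounded_update: "store_bounded B s \<Longrightarrow> \<bar>z\<bar> \<le> 2 ^ B \<Longrightarrow> store_bounded B (update s a i z)"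
  by (simp add: store_bounded_def)

text \<open>Every assignment proves here that its new value fits into the bound \<open>B\<close>;
  the size estimates of the later parts serve these obligations.\<close>

lemma runs_Put_bounded:
  assumes "store_bounded B s" and "(esize e)\<^sup>2 + (esize f)\<^sup>2 + 1 \<le> 1000" and "\<bar>aval f s\<bar> \<le> 2 ^ B"
    and "store_bounded B (update s a (aval e s) (aval f s)) \<Longrightarrow> Q (update s a (aval e s) (aval f s))"
  shows "runs (Put a e f) s (tick B) Q"
proof (rule runs_Put)
  show "Q (update s a (aval e s) (aval f s))"
    using assms(1,3,4) by (auto intro: store_bounded_update)
  have "acost e s + acost f s + 1 \<le> ((esize e)\<^sup>2 + (esize f)\<^sup>2 + 1) * (B + 2)"
    using acost_le[OF assms(1), of e] acost_le[OF assms(1), of f] by (simp add: algebra_simps)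
  also have "\<dots> \<le> tick B" unfolding tick_def using assms(2) by (intro mult_right_mono) auto
  finally show "acost e s + acost f s + 1 \<le> tick B" .
qed

text \<open>The 2 leaves room for the units charged by an enclosing \<open>Not\<close>,
  \<open>If\<close> or \<open>While\<close>.\<close>

lemma bcost_Less:
  assumes "store_bounded B s" and "(esize e)\<^sup>2 + (esize f)\<^sup>2 + 3 \<le> 1000"
  shows "bcost (Less e f) s + 2 \<le> tick B"
proof -
  have "bcost (Less e f) s + 2 \<le> ((esize e)\<^sup>2 + (esize f)\<^sup>2 + 3) * (B + 2)"
    using acost_le[OF assms(1), of e] acost_le[OF assms(1), of f] by (simp add: algebra_simps)
  also have "\<dots> \<le> tick B" unfolding tick_def using assms(2) by (intro mult_right_mono) auto
  finally show ?thesis .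
qed

abbreviation V :: "string \<Rightarrow> aexp" where
  "V a \<equiv> Get a (Num 0)"

abbreviation Set :: "string \<Rightarrow> aexp \<Rightarrow> com" where
  "Set a e \<equiv> Put a (Num 0) e"

definition For :: "string \<Rightarrow> string \<Rightarrow> com \<Rightarrow> com" where
  "For v bd P = Seq (Set v (Num 0)) (While (Less (V v) (V bd)) (Seq P (Set v (Plus (V v) (Num 1)))))"

lemma bits_small [simp]: "bits 0 = 1" "bits 1 = 2" "bits 2 = 3" "bits 3 = 3"
  unfolding bits_def bitlen_def by code_simp+

text \<open>\<open>counter\<close> keeps the invariant independent of the loop variable, whose value
  is supplied separately to the body. \<open>limit\<close> is required in every round because the
  guard reads the bound from the store each time.\<close>

lemma runs_For:
  assumes B: "store_bounded B s" and "I 0 s"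
    and step: "\<And>i s. i < N \<Longrightarrow> I i s \<Longrightarrow> s v 0 = int i \<Longrightarrow> store_bounded B s \<Longrightarrow>
      runs P s T (\<lambda>s'. store_bounded B s' \<and> s' v 0 = int i \<and> I (Suc i) s')"
    and counter: "\<And>i s x. I i s \<Longrightarrow> I i (update s v 0 x)"
    and limit: "\<And>i s. I i s \<Longrightarrow> s bd 0 = int N"
  shows "runs (For v bd P) s (N * (T + 2 * tick B) + 2 * tick B) (\<lambda>s'. store_bounded B s' \<and> I N s')"
proof -
  define J where "J i s \<longleftrightarrow> store_bounded B s \<and> s v 0 = int i \<and> I i s" for i s
  have N: "int N \<le> 2 ^ B" using limit[OF assms(2)] B unfolding store_bounded_def by (metis abs_of_nat)
  have "runs (While (Less (V v) (V bd)) (Seq P (Set v (Plus (V v) (Num 1))))) s'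
      (N * ((tick B - 2) + 1 + (T + tick B)) + ((tick B - 2) + 1)) (J N)" if "J 0 s'" for s'
  proof (rule runs_While[where I = J])
    show "J 0 s'" by fact
  next
    fix i s assume i: "i < N" and J: "J i s"
    have "runs (Seq P (Set v (Plus (V v) (Num 1)))) s (T + tick B) (J (Suc i))"
    proof (rule runs_Seq, rule runs_mono[where T = T, OF _ order_refl])
      show "runs P s T (\<lambda>s'. store_bounded B s' \<and> s' v 0 = int i \<and> I (Suc i) s')"
        using step i J by (simp add: J_def)
    next
      fix s' assume s': "store_bounded B s' \<and> s' v 0 = int i \<and> I (Suc i) s'"
      have "int i + 1 \<le> 2 ^ B" using i N by linarith
      then show "runs (Set v (Plus (V v) (Num 1))) s' (tick B) (J (Suc i))"
        using s' by (intro runs_Put_bounded) (auto simp: J_def power2_eq_square intro: counter)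
    qed
    then show "bval (Less (V v) (V bd)) s \<and> runs (Seq P (Set v (Plus (V v) (Num 1)))) s (T + tick B) (J (Suc i))"
      using J i limit[of i s] by (simp add: J_def)
  next
    fix s assume "J N s"
    then show "\<not> bval (Less (V v) (V bd)) s" using limit[of N s] by (simp add: J_def)
  next
    fix i s assume "J i s"
    then have "store_bounded B s" by (simp add: J_def)
    then show "bcost (Less (V v) (V bd)) s \<le> tick B - 2"
      using bcost_Less[of B s "V v" "V bd"] by (simp add: power2_eq_square)
  qed
  moreover have "runs (Set v (Num 0)) s (tick B) (J 0)"
    using assms(1,2) by (intro runs_Put_bounded) (auto simp: J_def power2_eq_square intro: counter)
  ultimately have "runs (For v bd P) s
      (tick B + (N * ((tick B - 2) + 1 + (T + tick B)) + ((tick B - 2) + 1))) (J N)"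
    unfolding For_def by (intro runs_Seq) (auto intro: runs_mono)
  then show ?thesis
  proof (rule runs_mono)
    have "N * ((tick B - 2) + 1 + (T + tick B)) \<le> N * (T + 2 * tick B)"
      by (intro mult_left_mono) (auto simp: tick_def)
    moreover have "tick B - 2 + 1 \<le> tick B" by (simp add: tick_def)
    ultimately have "N * ((tick B - 2) + 1 + (T + tick B)) + (tick B - 2 + 1) \<le> N * (T + 2 * tick B) + tick B"
      by (rule add_mono)
    then show "tick B + (N * ((tick B - 2) + 1 + (T + tick B)) + ((tick B - 2) + 1)) \<le> N * (T + 2 * tick B) + 2 * tick B"
      by simp
  qed (simp add: J_def)
qed

definition frame :: "string set \<Rightarrow> store \<Rightarrow> store \<Rightarrow> bool" where
  "frame W s s' \<longleftrightarrow> (\<forall>a. a \<notin> W \<longrightarrow> s' a = s a)"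

lemma frame_update [simp]: "frame W s s' \<Longrightarrow> a \<in> W \<Longrightarrow> frame W s (update s' a i z)"
  by (auto simp: frame_def update_def)

lemma frame_refl [simp]: "frame W s s"
  by (simp add: frame_def)

lemma frame_trans: "frame W s s' \<Longrightarrow> frame W' s' s'' \<Longrightarrow> W \<union> W' \<subseteq> W'' \<Longrightarrow> frame W'' s s''"
  unfolding frame_def by (metis UnCI subsetD)

section \<open>The rounding program\<close>

abbreviation entry :: "string \<Rightarrow> aexp" where
  "entry l \<equiv> Get ''A'' (Plus (Times (V ''i'') (V ''n'')) (V l))"

definition count_prog :: com where
  "count_prog =
    Seq (Set ''k'' (Num 0)) (Seq (Set ''K'' (Num 1))
      (For ''j'' ''n''
        (Seq (Set ''k'' (Plus (V ''k'') (Get ''A'' (V ''j''))))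
          (Set ''K'' (Times (V ''K'') (Times (Get ''cden'' (V ''j'')) (Get ''xden'' (V ''j''))))))))"

text \<open>\<open>K\<close> is a multiple of every denominator, so each \<open>Div\<close> is
  exact. The formula for \<open>Y\<close> comes from Z * z l = 2 * k * K * (x l + 1 / k) / 2 = K *
  (k * x l + 1).\<close>

definition scale_prog :: com where
  "scale_prog =
    Seq (Set ''Z'' (Times (Num 2) (Times (V ''k'') (V ''K'')))) (Seq (Set ''P'' (Num 1)) (Seq (Set ''O'' (Num 0))
      (For ''j'' ''n''
        (Seq (Put ''C'' (V ''j'') (Times (Get ''cnum'' (V ''j'')) (Div (V ''K'') (Get ''cden'' (V ''j'')))))
        (Seq (Put ''Y'' (V ''j'') (Times (Plus (Times (V ''k'') (Get ''xnum'' (V ''j''))) (Get ''xden'' (V ''j'')))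
            (Div (V ''K'') (Get ''xden'' (V ''j'')))))
        (Seq (Set ''O'' (Plus (V ''O'') (Times (Get ''C'' (V ''j'')) (Get ''Y'' (V ''j'')))))
          (Set ''P'' (Times (V ''P'') (V ''Z'')))))))))"

definition base_prog :: com where
  "base_prog =
    Seq (Set ''E'' (V ''O'')) (Seq (Set ''R'' (Num 1)) (Seq (Set ''b'' (Num 0))
      (While (Not (Less (Times (Num 2) (Times (V ''m'') (Times (V ''K'') (V ''Z'')))) (V ''E'')))
        (Seq (Set ''E'' (Times (Num 2) (V ''E'')))
        (Seq (Set ''R'' (Times (Num 3) (V ''R'')))
          (Set ''b'' (Plus (V ''b'') (Num 1))))))))"

definition row_prog :: com where
  "row_prog =
    Seq (Set ''u'' (Num 1)) (Seq (Set ''w'' (Num 0))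
      (For ''l'' ''n''
        (Seq (Set ''u'' (Times (V ''u'') (Plus (V ''Z'') (Times (V ''b'') (Times (entry ''l'') (Get ''Y'' (V ''l'')))))))
          (Set ''w'' (Plus (V ''w'') (Times (entry ''l'') (Times (Get ''C'' (V ''l'')) (Get ''Y'' (V ''l'')))))))))"

text \<open>The entry of \<open>Y\<close> is cleared tentatively, that of \<open>C\<close> for good,
  with \<open>q\<close> keeping the weight. Zeros in front of \<open>C\<close> let the row loop,
  which always visits all columns, sum exactly the tail after column \<open>j\<close>.\<close>

definition reset_prog :: com where
  "reset_prog =
    Seq (Set ''q'' (Get ''C'' (V ''j''))) (Seq (Put ''C'' (V ''j'') (Num 0)) (Seq (Put ''Y'' (V ''j'') (Num 0))
      (Seq (Put ''y'' (V ''j'') (Num 0)) (Set ''H'' (Num 0)))))"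

definition price_prog :: com where
  "price_prog =
    For ''i'' ''m'' (Seq row_prog (Set ''H'' (Plus (V ''H'') (Times (entry ''j'')
      (Times (V ''u'') (Plus (Times (V ''q'') (V ''Z'')) (Times (V ''b'') (V ''w''))))))))"

definition accept_prog :: com where
  "accept_prog =
    If (Less (Times (V ''G'') (V ''q'')) (Times (V ''H'') (V ''O''))) Skip
      (Seq (Put ''Y'' (V ''j'') (V ''Z'')) (Put ''y'' (V ''j'') (Num 1)))"

definition column_prog :: com where
  "column_prog = Seq reset_prog (Seq price_prog accept_prog)"

definition round_prog :: com where
  "round_prog =
    Seq (Set ''G'' (Times (Num 2) (Times (V ''R'') (Times (V ''m'') (Times (Times (V ''Z'') (V ''P'')) (Times (V ''K'') (V ''Z'')))))))
      (For ''j'' ''n'' column_prog)"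

definition rounding_prog :: com where
  "rounding_prog = Seq count_prog (Seq scale_prog (Seq base_prog round_prog))"

lemma one_le_mult_int: "1 \<le> x \<Longrightarrow> 1 \<le> y \<Longrightarrow> 1 \<le> x * y" for x y :: int
  using mult_mono[of 1 x 1 y] by simp

text \<open>All quantities of the rounding are kept integral: with the common denominator \<open>K\<close>, the program
  works with \<open>C l = K * c l\<close> and \<open>X l = Z * z l\<close>, and its array \<open>Y\<close> holds \<open>Z\<close> times the vector being rounded.\<close>

locale machine =
  fixes m n B :: nat and A :: "nat \<Rightarrow> nat \<Rightarrow> int" and cn cd xn xd :: "nat \<Rightarrow> int"
begin

definition k :: int where "k = (\<Sum>l<n. A 0 l)"
definition K :: int where "K = (\<Prod>l<n. cd l * xd l)"
definition Z :: int where "Z = 2 * (k * K)"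
definition C :: "nat \<Rightarrow> int" where "C l = cn l * (K div cd l)"
definition X :: "nat \<Rightarrow> int" where "X l = (k * xn l + xd l) * (K div xd l)"
definition total :: int where "total = (\<Sum>l<n. C l * X l)"
definition \<beta> :: nat where "\<beta> = (LEAST b. 2 * (int m * (K * Z)) < 2 ^ b * total)"
text \<open>The cutoff is \<open>2 * 3 ^ \<beta> * m * K * Z / total\<close>. Multiplying the
  acceptance test by \<open>total\<close> and by the scale \<open>Z ^ n * (K * Z)\<close> of
  \<open>H\<close> leaves \<open>G * C j\<close> to be compared with \<open>H * total\<close>; a
  factor \<open>K\<close> of that product sits in \<open>C j\<close>.\<close>

definition G :: int where "G = 2 * (3 ^ \<beta> * (int m * ((Z * Z ^ n) * (K * Z))))"
definition U :: "(nat \<Rightarrow> int) \<Rightarrow> nat \<Rightarrow> int" where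
  "U v i = (\<Prod>l<n. Z + int \<beta> * (A i l * v l))"
text \<open>The zero for \<open>l < j\<close> mirrors the cleared prefix of the array
  \<open>C\<close>.\<close>

definition W :: "nat \<Rightarrow> (nat \<Rightarrow> int) \<Rightarrow> nat \<Rightarrow> int" where
  "W j v i = (\<Sum>l<n. A i l * ((if l < j then 0 else C l) * v l))"
definition H :: "nat \<Rightarrow> (nat \<Rightarrow> int) \<Rightarrow> int" where
  "H j v = (\<Sum>i<m. A i j * (U v i * (C j * Z + int \<beta> * W (Suc j) v i)))"

primrec Y :: "nat \<Rightarrow> nat \<Rightarrow> int" where
  "Y 0 = X"
| "Y (Suc j) = (Y j)(j := if G * C j < H j ((Y j)(j := 0)) * total then 0 else Z)"

definition inputs :: "store \<Rightarrow> bool" where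
  "inputs s \<longleftrightarrow> s ''m'' 0 = int m \<and> s ''n'' 0 = int n \<and>
     (\<forall>i<m. \<forall>l<n. s ''A'' (int i * int n + int l) = A i l) \<and>
     (\<forall>l<n. s ''cnum'' (int l) = cn l \<and> s ''cden'' (int l) = cd l \<and>
       s ''xnum'' (int l) = xn l \<and> s ''xden'' (int l) = xd l)"

lemma inputs_frame:
  assumes "inputs s" and "frame S s s'"
    and "S \<inter> {''m'', ''n'', ''A'', ''cnum'', ''cden'', ''xnum'', ''xden''} = {}"
  shows "inputs s'"
proof -
  have "\<forall>a \<in> {''m'', ''n'', ''A'', ''cnum'', ''cden'', ''xnum'', ''xden''}. s' a = s a"
    using assms(2,3) unfolding frame_def by blast
  then show ?thesis using assms(1) by (simp add: inputs_def)
qed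

end

locale proper_machine = machine +
  assumes mn: "1 \<le> m" "1 \<le> n"
    and entries: "i < m \<Longrightarrow> l < n \<Longrightarrow> A i l = 0 \<or> A i l = 1"
    and dens: "l < n \<Longrightarrow> 1 \<le> cd l" "l < n \<Longrightarrow> 1 \<le> xd l"
    and k: "1 \<le> k"
    and C: "l < n \<Longrightarrow> 1 \<le> C l" "l < n \<Longrightarrow> C l \<le> K"
    and X: "l < n \<Longrightarrow> 1 \<le> X l" "l < n \<Longrightarrow> X l \<le> Z"
begin

lemma K_ge: "1 \<le> K"
  unfolding K_def using dens by (intro prod_ge_1) (simp add: one_le_mult_int)

lemma Z_ge: "1 \<le> Z" "K \<le> Z"
proof -
  have "1 * K \<le> k * K" using k K_ge by (intro mult_right_mono) auto
  moreover have "1 \<le> k * K" using k K_ge by (rule one_le_mult_int)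
  ultimately show "1 \<le> Z" "K \<le> Z" unfolding Z_def by linarith+
qed

lemma KZ_ge: "1 \<le> K * Z"
  using K_ge Z_ge(1) by (rule one_le_mult_int)

lemma term_bounds:
  assumes "l < n"
  shows "1 \<le> C l * X l" and "C l * X l \<le> K * Z"
  using C[OF assms] X[OF assms] by (auto intro!: one_le_mult_int mult_mono)

lemma total_nonneg: "j \<le> n \<Longrightarrow> 0 \<le> (\<Sum>l<j. C l * X l)"
  by (intro sum_nonneg order_trans[OF zero_le_one term_bounds(1)]) auto

lemma total_ge: "1 \<le> total"
proof -
  have "total = C 0 * X 0 + (\<Sum>l\<in>{..<n} - {0}. C l * X l)"
    unfolding total_def using mn by (intro sum.remove) auto
  moreover have "0 \<le> (\<Sum>l\<in>{..<n} - {0}. C l * X l)"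
    by (intro sum_nonneg order_trans[OF zero_le_one term_bounds(1)]) auto
  ultimately show ?thesis using term_bounds(1)[of 0] mn by linarith
qed

lemma base_exists: "2 * (int m * (K * Z)) < 2 ^ \<beta> * total"
  and base_minimal: "i < \<beta> \<Longrightarrow> 2 ^ i * total \<le> 2 * (int m * (K * Z))"
proof -
  let ?M = "2 * (int m * (K * Z))"
  have "0 \<le> ?M" using KZ_ge by simp
  \<comment> \<open>A crude witness, enough for the least exponent to exist; a bound linear in the
    input size follows in \<open>sizes_bounded\<close>.\<close>
  then have "?M < 2 ^ nat ?M"
    using of_nat_less_two_power[of "nat ?M", where 'a = int] by simp
  also have "(2 :: int) ^ nat ?M \<le> 2 ^ nat ?M * total"
    using mult_left_mono[OF total_ge, of "2 ^ nat ?M"] by simp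
  finally show "?M < 2 ^ \<beta> * total" unfolding \<beta>_def by (rule LeastI)
  show "2 ^ i * total \<le> ?M" if "i < \<beta>"
    using not_less_Least[of i "\<lambda>b. ?M < 2 ^ b * total"] that unfolding \<beta>_def by simp
qed

lemma Y_range: "l < n \<Longrightarrow> 0 \<le> Y j l" "l < n \<Longrightarrow> Y j l \<le> Z"
  using X Z_ge by (induction j) (auto intro: order_trans[OF zero_le_one])

end

section \<open>Execution of the program stages within a fixed bit length\<close>

text \<open>\<open>B1\<close> controls the partial sums of \<open>total\<close> and of the tails,
  \<open>B2\<close> the last doubling of \<open>E\<close>, \<open>B3\<close> the number
  \<open>G\<close> with all its factors, and \<open>B4\<close> the running products \<open>u\<close>
  and the running sums \<open>H\<close>.\<close>

locale bounded_machine = proper_machine +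
  assumes B1: "int n * (K * Z) \<le> 2 ^ B" and B2: "4 * (int m * (K * Z)) \<le> 2 ^ B" and B3: "G \<le> 2 ^ B"
    and B4: "int m * ((Z * (1 + int \<beta>)) ^ n * (K * Z + int \<beta> * (int n * (K * Z)))) \<le> 2 ^ B"
begin

lemma KZ_bounds: "K * Z \<le> 2 ^ B" "K \<le> 2 ^ B" "Z \<le> 2 ^ B" "int n \<le> 2 ^ B"
proof -
  have "1 * (K * Z) \<le> int n * (K * Z)" using mn KZ_ge by (intro mult_right_mono) auto
  then show KZ: "K * Z \<le> 2 ^ B" using B1 by simp
  have "K * 1 \<le> K * Z" "1 * Z \<le> K * Z"
    using K_ge Z_ge by (auto intro: mult_left_mono mult_right_mono simp del: mult_1_left mult_1_right)
  then show "K \<le> 2 ^ B" "Z \<le> 2 ^ B" using KZ by auto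
  have "int n * 1 \<le> int n * (K * Z)" using KZ_ge by (intro mult_left_mono) auto
  then show "int n \<le> 2 ^ B" using B1 by linarith
qed

lemma total_le:
  assumes "j \<le> n"
  shows "(\<Sum>l<j. C l * X l) \<le> 2 ^ B"
proof -
  have "(\<Sum>l<j. C l * X l) \<le> (\<Sum>l<j. K * Z)" using term_bounds(2) assms by (intro sum_mono) auto
  also have "\<dots> = int j * (K * Z)" by simp
  also have "\<dots> \<le> int n * (K * Z)" using assms KZ_ge by (intro mult_right_mono) auto
  finally show ?thesis using B1 by linarith
qed

lemma count_runs:
  assumes B: "store_bounded B s0" and inp: "inputs s0"
  shows "runs count_prog s0 (tick B + (tick B + (n * ((tick B + tick B) + 2 * tick B) + 2 * tick B)))
    (\<lambda>s. store_bounded B s \<and> (frame {''k'', ''K'', ''j''} s0 s \<and> s ''k'' 0 = k \<and> s ''K'' 0 = K))"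
proof -
  define I where "I j s \<longleftrightarrow> frame {''k'', ''K'', ''j''} s0 s \<and> s ''k'' 0 = (\<Sum>l<j. A 0 l) \<and>
    s ''K'' 0 = (\<Prod>l<j. cd l * xd l)" for j s
  have step: "runs (Seq (Set ''k'' (Plus (V ''k'') (Get ''A'' (V ''j''))))
      (Set ''K'' (Times (V ''K'') (Times (Get ''cden'' (V ''j'')) (Get ''xden'' (V ''j'')))))) s
      (tick B + tick B) (\<lambda>s'. store_bounded B s' \<and> s' ''j'' 0 = int j \<and> I (Suc j) s')"
    if j: "j < n" and I: "I j s" and sj: "s ''j'' 0 = int j" and b: "store_bounded B s" for j s
  proof -
    have inp': "inputs s" using I inputs_frame[OF inp, of "{''k'', ''K'', ''j''}" s] by (simp add: I_def)
    have "s ''A'' (int 0 * int n + int j) = A 0 j" using inp' mn j unfolding inputs_def by (metis less_le_trans zero_less_one)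
    then have a: "s ''A'' (int j) = A 0 j" by simp
    have d: "s ''cden'' (int j) = cd j" "s ''xden'' (int j) = xd j" using inp' j by (auto simp: inputs_def)
    have A0: "0 \<le> A 0 l" "A 0 l \<le> 1" if "l < Suc j" for l
      using entries[of 0 l] mn j that by force+
    have "0 \<le> (\<Sum>l<Suc j. A 0 l)" using A0 by (intro sum_nonneg) auto
    moreover have "(\<Sum>l<Suc j. A 0 l) \<le> (\<Sum>l<Suc j. 1)" using A0 by (intro sum_mono) auto
    moreover have jB: "1 + int j \<le> 2 ^ B" using KZ_bounds(4) j by linarith
    ultimately have ks: "0 \<le> (\<Sum>l<j. A 0 l) + A 0 j" "(\<Sum>l<j. A 0 l) + A 0 j \<le> 2 ^ B"
      using jB by auto
    have pos: "1 \<le> cd l * xd l" if "l < n" for l using dens that by (intro one_le_mult_int) auto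
    have "0 \<le> (\<Prod>l<Suc j. cd l * xd l)" using j by (intro prod_nonneg ballI order_trans[OF zero_le_one pos]) auto
    moreover have "(\<Prod>l<Suc j. cd l * xd l) \<le> K"
      unfolding K_def using j
      by (intro prod_mono2) (auto intro: pos order_trans[OF zero_le_one pos])
    ultimately have Ks: "0 \<le> (\<Prod>l<j. cd l * xd l) * (cd j * xd j)"
        "(\<Prod>l<j. cd l * xd l) * (cd j * xd j) \<le> 2 ^ B"
      using KZ_bounds(2) by auto
    show ?thesis
      using I sj b j a d ks Ks
      by (intro runs_Seq runs_Put_bounded) (auto simp: I_def power2_eq_square)
  qed
  have loop: "runs (For ''j'' ''n'' (Seq (Set ''k'' (Plus (V ''k'') (Get ''A'' (V ''j''))))
      (Set ''K'' (Times (V ''K'') (Times (Get ''cden'' (V ''j'')) (Get ''xden'' (V ''j''))))))) s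
      (n * ((tick B + tick B) + 2 * tick B) + 2 * tick B) (\<lambda>s'. store_bounded B s' \<and> I n s')"
    if "store_bounded B s" "I 0 s" for s
    using that
  proof (rule runs_For[where I = I])
    show "s ''n'' 0 = int n" if "I i s" for i s
      using that inputs_frame[OF inp, of "{''k'', ''K'', ''j''}" s] by (simp add: I_def inputs_def)
  qed (use step in \<open>auto simp: I_def\<close>)
  show ?thesis
    unfolding count_prog_def using B
    by (intro runs_Seq runs_Put_bounded runs_mono[OF loop])
      (auto simp: I_def k_def K_def power2_eq_square)
qed

lemma le_mult_ge_one: "1 \<le> x \<Longrightarrow> 1 \<le> y \<Longrightarrow> x \<le> x * y \<and> y \<le> x * y" for x y :: int
  by (metis le_cases mult.commute mult_cancel_right1 mult_right_mono mult_1 order_trans zero_le_one)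

text \<open>\<open>G\<close> is a product of factors that are at least 1, so it dominates each of
  them; \<open>\<beta>\<close> is in turn below \<open>3 ^ \<beta>\<close>.\<close>

lemma G_bounds: "0 \<le> G" "Z ^ n \<le> 2 ^ B" "3 ^ \<beta> \<le> (2::int) ^ B" "int \<beta> \<le> 2 ^ B"
proof -
  define d where "d = int m * ((Z * Z ^ n) * (K * Z))"
  have Zn: "1 \<le> Z ^ n" using Z_ge by (intro one_le_power)
  have 1: "1 \<le> Z * Z ^ n" using Zn Z_ge by (intro one_le_mult_int)
  have 2: "1 \<le> (Z * Z ^ n) * (K * Z)" using 1 KZ_ge by (rule one_le_mult_int)
  have m: "1 \<le> int m" using mn by simp
  have d: "1 \<le> d" unfolding d_def using m 2 by (rule one_le_mult_int)
  have t: "1 \<le> (3::int) ^ \<beta>" by (intro one_le_power) simp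
  have Gd: "G = 2 * (3 ^ \<beta> * d)" by (simp add: G_def d_def)
  have td: "3 ^ \<beta> \<le> 3 ^ \<beta> * d" "d \<le> 3 ^ \<beta> * d" using le_mult_ge_one[OF t d] by auto
  show "0 \<le> G" using td d unfolding Gd by linarith
  show t2: "3 ^ \<beta> \<le> (2::int) ^ B" using td t B3 unfolding Gd by linarith
  have "Z ^ n \<le> d"
    using le_mult_ge_one[OF Z_ge(1) Zn] le_mult_ge_one[OF 1 KZ_ge] le_mult_ge_one[OF m 2]
    unfolding d_def by linarith
  then show "Z ^ n \<le> 2 ^ B" using td d B3 unfolding Gd by linarith
  have "\<beta> < 3 ^ \<beta>" by (rule less_exp[THEN less_le_trans]) (simp add: power_mono)
  then have "int \<beta> \<le> 3 ^ \<beta>" by (metis less_imp_le of_nat_le_iff of_nat_numeral of_nat_power)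
  then show "int \<beta> \<le> 2 ^ B" using t2 by linarith
qed

lemma scale_runs:
  assumes B: "store_bounded B s0" and inp: "inputs s0" and k0: "s0 ''k'' 0 = k" and K0: "s0 ''K'' 0 = K"
  shows "runs scale_prog s0
      (tick B + (tick B + (tick B + (n * ((tick B + (tick B + (tick B + tick B))) + 2 * tick B) + 2 * tick B))))
    (\<lambda>s. store_bounded B s \<and> (frame {''Z'', ''P'', ''O'', ''C'', ''Y'', ''j''} s0 s \<and> s ''Z'' 0 = Z \<and>
      s ''P'' 0 = Z ^ n \<and> s ''O'' 0 = total \<and> (\<forall>l<n. s ''C'' (int l) = C l \<and> s ''Y'' (int l) = X l)))"
proof -
  define I where "I j s \<longleftrightarrow> frame {''Z'', ''P'', ''O'', ''C'', ''Y'', ''j''} s0 s \<and> s ''Z'' 0 = Z \<and>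
      s ''P'' 0 = Z ^ j \<and> s ''O'' 0 = (\<Sum>l<j. C l * X l) \<and>
      (\<forall>l<j. s ''C'' (int l) = C l \<and> s ''Y'' (int l) = X l)" for j s
  let ?body = "(Seq (Put ''C'' (V ''j'') (Times (Get ''cnum'' (V ''j'')) (Div (V ''K'') (Get ''cden'' (V ''j'')))))
        (Seq (Put ''Y'' (V ''j'') (Times (Plus (Times (V ''k'') (Get ''xnum'' (V ''j''))) (Get ''xden'' (V ''j'')))
            (Div (V ''K'') (Get ''xden'' (V ''j'')))))
        (Seq (Set ''O'' (Plus (V ''O'') (Times (Get ''C'' (V ''j'')) (Get ''Y'' (V ''j'')))))
          (Set ''P'' (Times (V ''P'') (V ''Z''))))))"
  have fr: "inputs s \<and> s ''k'' 0 = k \<and> s ''K'' 0 = K" if "I j s" for j s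
    using that inputs_frame[OF inp, of "{''Z'', ''P'', ''O'', ''C'', ''Y'', ''j''}" s] k0 K0
    by (simp add: I_def frame_def)
  have step: "runs ?body s (tick B + (tick B + (tick B + tick B)))
      (\<lambda>s'. store_bounded B s' \<and> s' ''j'' 0 = int j \<and> I (Suc j) s')"
    if j: "j < n" and I: "I j s" and sj: "s ''j'' 0 = int j" and b: "store_bounded B s" for j s
  proof -
    have in': "s ''cnum'' (int j) = cn j" "s ''cden'' (int j) = cd j" "s ''xnum'' (int j) = xn j"
      "s ''xden'' (int j) = xd j" "s ''k'' 0 = k" "s ''K'' 0 = K"
      using fr[OF I] j by (auto simp: inputs_def)
    have c: "cn j * (K div cd j) = C j" "\<bar>C j\<bar> \<le> 2 ^ B"
      using C[OF j] KZ_bounds(2) by (auto simp: C_def)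
    have x: "(k * xn j + xd j) * (K div xd j) = X j" "\<bar>X j\<bar> \<le> 2 ^ B"
      using X[OF j] KZ_bounds(3) by (auto simp: X_def)
    have o: "\<bar>(\<Sum>l<j. C l * X l) + C j * X j\<bar> \<le> 2 ^ B"
      using total_nonneg[of "Suc j"] total_le[of "Suc j"] j by simp
    have "0 \<le> Z ^ Suc j" using Z_ge by simp
    moreover have "Z ^ Suc j \<le> Z ^ n" using Z_ge j by (intro power_increasing) auto
    ultimately have p: "\<bar>Z ^ j * Z\<bar> \<le> 2 ^ B" using G_bounds(2) by (simp add: mult.commute)
    show ?thesis
      using I sj b j in' c x o p
      by (intro runs_Seq runs_Put_bounded) (auto simp: I_def power2_eq_square less_Suc_eq mult.commute)
  qed
  have loop: "runs (For ''j'' ''n'' ?body) s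
      (n * ((tick B + (tick B + (tick B + tick B))) + 2 * tick B) + 2 * tick B) (\<lambda>s'. store_bounded B s' \<and> I n s')"
    if "store_bounded B s" "I 0 s" for s
    using that
  proof (rule runs_For[where I = I])
    show "s ''n'' 0 = int n" if "I i s" for i s
      using fr[OF that] by (simp add: inputs_def)
  qed (use step in \<open>auto simp: I_def\<close>)
  have Zb: "\<bar>2 * (k * K)\<bar> \<le> 2 ^ B" using Z_ge KZ_bounds(3) by (simp add: Z_def)
  show ?thesis
    unfolding scale_prog_def using B k0 K0 Zb
    by (intro runs_Seq runs_Put_bounded runs_mono[OF loop])
      (auto simp: I_def total_def Z_def power2_eq_square)
qed

lemma base_runs:
  assumes B: "store_bounded B s0" and inp: "inputs s0"
    and s0: "s0 ''K'' 0 = K" "s0 ''Z'' 0 = Z" "s0 ''O'' 0 = total"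
  shows "runs base_prog s0
      (tick B + (tick B + (tick B + (\<beta> * (tick B + 1 + (tick B + (tick B + tick B))) + (tick B + 1)))))
    (\<lambda>s. store_bounded B s \<and> (frame {''E'', ''R'', ''b''} s0 s \<and> s ''R'' 0 = 3 ^ \<beta> \<and> s ''b'' 0 = int \<beta>))"
proof -
  define I where "I i s \<longleftrightarrow> store_bounded B s \<and> frame {''E'', ''R'', ''b''} s0 s \<and> s ''E'' 0 = 2 ^ i * total \<and>
    s ''R'' 0 = 3 ^ i \<and> s ''b'' 0 = int i" for i s
  let ?b = "Not (Less (Times (Num 2) (Times (V ''m'') (Times (V ''K'') (V ''Z'')))) (V ''E''))"
  let ?body = "(Seq (Set ''E'' (Times (Num 2) (V ''E'')))
        (Seq (Set ''R'' (Times (Num 3) (V ''R''))) (Set ''b'' (Plus (V ''b'') (Num 1)))))"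
  have fr: "s ''m'' 0 = int m \<and> s ''K'' 0 = K \<and> s ''Z'' 0 = Z" if "I j s" for j s
    using that inp s0 by (simp add: I_def frame_def inputs_def)
  have step: "bval ?b s \<and> runs ?body s (tick B + (tick B + tick B)) (I (Suc i))"
    if i: "i < \<beta>" and I: "I i s" for i s
  proof
    show "bval ?b s" using fr[OF I] I base_minimal[OF i] by (simp add: I_def)
    have "0 \<le> 2 ^ i * total" using total_ge by simp
    \<comment> \<open>The guard still held before this doubling, so the new value is at most twice
      the limit in the guard. This is the 4 in \<open>B2\<close>.\<close>
    then have e: "\<bar>2 * (2 ^ i * total)\<bar> \<le> 2 ^ B" using base_minimal[OF i] B2 by linarith
    have "(3::int) ^ Suc i \<le> 3 ^ \<beta>" using i by (intro power_increasing) auto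
    then have r: "(3::int) * 3 ^ i \<le> 2 ^ B" using G_bounds(3) by simp
    have bb: "int i + 1 \<le> 2 ^ B" using i G_bounds(4) by linarith
    show "runs ?body s (tick B + (tick B + tick B)) (I (Suc i))"
      using I e r bb
      by (intro runs_Seq runs_Put_bounded) (auto simp: I_def power2_eq_square)
  qed
  have loop: "runs (While ?b ?body) s (\<beta> * (tick B + 1 + (tick B + (tick B + tick B))) + (tick B + 1)) (I \<beta>)"
    if "I 0 s" for s
    using that step
  proof (rule runs_While[where I = I])
    show "\<not> bval ?b s" if "I \<beta> s" for s
      using that fr[OF that] base_exists by (simp add: I_def)
    show "bcost ?b s \<le> tick B" if "I i s" for i s
      using bcost_Less[of B s "Times (Num 2) (Times (V ''m'') (Times (V ''K'') (V ''Z'')))" "V ''E''"] that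
      by (simp add: I_def power2_eq_square)
  qed
  have "\<bar>total\<bar> \<le> 2 ^ B" using total_le[of n] total_ge by (simp add: total_def)
  then show ?thesis
    unfolding base_prog_def using B s0
    by (intro runs_Seq runs_Put_bounded runs_mono[OF loop]) (auto simp: I_def power2_eq_square)
qed

text \<open>Prefixes \<open>t\<close> are treated because every intermediate value of
  \<open>u\<close> has to fit. All factors are at most \<open>Z * (1 + int \<beta>)\<close>, and
  since this is at least 1 the exponent may be raised from \<open>t\<close> to
  \<open>n\<close>.\<close>

lemma U_bounds:
  assumes "i < m" and v: "\<forall>l<n. 0 \<le> v l \<and> v l \<le> Z" and "t \<le> n"
  shows "0 \<le> (\<Prod>l<t. Z + int \<beta> * (A i l * v l))"
    and "(\<Prod>l<t. Z + int \<beta> * (A i l * v l)) \<le> (Z * (1 + int \<beta>)) ^ n"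
proof -
  have f: "0 \<le> Z + int \<beta> * (A i l * v l)" "Z + int \<beta> * (A i l * v l) \<le> Z * (1 + int \<beta>)" if "l < t" for l
    using entries[OF assms(1), of l] v[rule_format, of l] Z_ge that assms(3) mult_left_mono[of "v l" Z "int \<beta>"]
    by (auto simp: algebra_simps)
  show "0 \<le> (\<Prod>l<t. Z + int \<beta> * (A i l * v l))" using f by (intro prod_nonneg) auto
  have "(\<Prod>l<t. Z + int \<beta> * (A i l * v l)) \<le> (\<Prod>l<t. Z * (1 + int \<beta>))"
    using f by (intro prod_mono) auto
  also have "\<dots> = (Z * (1 + int \<beta>)) ^ t" by simp
  also have "\<dots> \<le> (Z * (1 + int \<beta>)) ^ n"
    using assms(3) one_le_mult_int[OF Z_ge(1), of "1 + int \<beta>"] by (intro power_increasing) auto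
  finally show "(\<Prod>l<t. Z + int \<beta> * (A i l * v l)) \<le> (Z * (1 + int \<beta>)) ^ n" .
qed

lemma W_bounds:
  assumes "i < m" and v: "\<forall>l<n. 0 \<le> v l \<and> v l \<le> Z" and "t \<le> n"
  shows "0 \<le> (\<Sum>l<t. A i l * ((if l < j then 0 else C l) * v l))"
    and "(\<Sum>l<t. A i l * ((if l < j then 0 else C l) * v l)) \<le> int n * (K * Z)"
proof -
  have f: "0 \<le> A i l * ((if l < j then 0 else C l) * v l) \<and> A i l * ((if l < j then 0 else C l) * v l) \<le> K * Z"
    if "l < t" for l
    using entries[OF assms(1), of l] v[rule_format, of l] C[of l] K_ge Z_ge that assms(3)
      mult_mono[of "C l" K "v l" Z] by auto
  show "0 \<le> (\<Sum>l<t. A i l * ((if l < j then 0 else C l) * v l))" using f by (intro sum_nonneg) auto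
  have "(\<Sum>l<t. A i l * ((if l < j then 0 else C l) * v l)) \<le> (\<Sum>l<t. K * Z)"
    using f by (intro sum_mono) auto
  also have "\<dots> = int t * (K * Z)" by simp
  also have "\<dots> \<le> int n * (K * Z)" using assms(3) KZ_ge by (intro mult_right_mono) auto
  finally show "(\<Sum>l<t. A i l * ((if l < j then 0 else C l) * v l)) \<le> int n * (K * Z)" .
qed

lemma U_le: "(Z * (1 + int \<beta>)) ^ n \<le> 2 ^ B"
proof -
  have 1: "1 \<le> (Z * (1 + int \<beta>)) ^ n" using Z_ge by (intro one_le_power one_le_mult_int) auto
  have 2: "1 \<le> K * Z + int \<beta> * (int n * (K * Z))"
    using KZ_ge by (intro order_trans[OF KZ_ge]) simp
  have "1 \<le> int m" using mn by simp
  with le_mult_ge_one[OF 1 2] le_mult_ge_one[OF this one_le_mult_int[OF 1 2]] B4 show ?thesis by linarith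
qed

lemma price_bounds:
  assumes v: "\<forall>l<n. 0 \<le> v l \<and> v l \<le> Z" and "t \<le> m" and j: "j < n"
  shows "0 \<le> (\<Sum>i<t. A i j * (U v i * (C j * Z + int \<beta> * W (Suc j) v i)))"
    and "(\<Sum>i<t. A i j * (U v i * (C j * Z + int \<beta> * W (Suc j) v i))) \<le> 2 ^ B"
proof -
  let ?M = "(Z * (1 + int \<beta>)) ^ n * (K * Z + int \<beta> * (int n * (K * Z)))"
  have f: "0 \<le> A i j * (U v i * (C j * Z + int \<beta> * W (Suc j) v i)) \<and>
      A i j * (U v i * (C j * Z + int \<beta> * W (Suc j) v i)) \<le> ?M" if i: "i < t" for i
  proof -
    have i: "i < m" using i assms(2) by simp
    have u: "0 \<le> U v i" "U v i \<le> (Z * (1 + int \<beta>)) ^ n"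
      using U_bounds[OF i v, of n] by (auto simp: U_def)
    have w: "0 \<le> W (Suc j) v i" "W (Suc j) v i \<le> int n * (K * Z)"
      using W_bounds[OF i v, of n "Suc j"] by (auto simp: W_def)
    have cz: "0 \<le> C j * Z" "C j * Z \<le> K * Z" using C[OF j] Z_ge by (auto intro: mult_right_mono)
    have bw: "0 \<le> int \<beta> * W (Suc j) v i" "int \<beta> * W (Suc j) v i \<le> int \<beta> * (int n * (K * Z))"
      using w by (auto intro: mult_left_mono)
    have "U v i * (C j * Z + int \<beta> * W (Suc j) v i) \<le> ?M"
      by (rule mult_mono[OF u(2) add_mono[OF cz(2) bw(2)]]) (use cz bw u in linarith)+
    moreover have "0 \<le> U v i * (C j * Z + int \<beta> * W (Suc j) v i)"
      by (rule mult_nonneg_nonneg[OF u(1) add_nonneg_nonneg[OF cz(1) bw(1)]])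
    ultimately show ?thesis using entries[OF i j] by auto
  qed
  show "0 \<le> (\<Sum>i<t. A i j * (U v i * (C j * Z + int \<beta> * W (Suc j) v i)))"
    using f by (intro sum_nonneg) auto
  have M: "0 \<le> ?M"
    using Z_ge K_ge by (intro mult_nonneg_nonneg zero_le_power add_nonneg_nonneg) auto
  have "(\<Sum>i<t. A i j * (U v i * (C j * Z + int \<beta> * W (Suc j) v i))) \<le> (\<Sum>i<t. ?M)"
    using f by (intro sum_mono) auto
  also have "\<dots> = int t * ?M" by simp
  also have "\<dots> \<le> int m * ?M" using assms(2) M by (intro mult_right_mono) auto
  finally show "(\<Sum>i<t. A i j * (U v i * (C j * Z + int \<beta> * W (Suc j) v i))) \<le> 2 ^ B"
    using B4 by linarith
qed

definition row_time :: nat where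
  "row_time = tick B + (tick B + (n * ((tick B + tick B) + 2 * tick B) + 2 * tick B))"

lemma row_runs:
  assumes B: "store_bounded B s0" and inp: "inputs s0"
    and s0: "s0 ''Z'' 0 = Z" "s0 ''b'' 0 = int \<beta>" "s0 ''i'' 0 = int i"
    and i: "i < m"
    and vs: "\<forall>l<n. s0 ''Y'' (int l) = v l" and cs: "\<forall>l<n. s0 ''C'' (int l) = (if l < j then 0 else C l)"
    and v: "\<forall>l<n. 0 \<le> v l \<and> v l \<le> Z"
  shows "runs row_prog s0 row_time
    (\<lambda>s. store_bounded B s \<and> (frame {''u'', ''w'', ''l''} s0 s \<and> s ''u'' 0 = U v i \<and> s ''w'' 0 = W j v i))"
proof -
  define I where "I t s \<longleftrightarrow> frame {''u'', ''w'', ''l''} s0 s \<and>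
    s ''u'' 0 = (\<Prod>l<t. Z + int \<beta> * (A i l * v l)) \<and>
    s ''w'' 0 = (\<Sum>l<t. A i l * ((if l < j then 0 else C l) * v l))" for t s
  let ?body = "(Seq (Set ''u'' (Times (V ''u'') (Plus (V ''Z'') (Times (V ''b'') (Times (entry ''l'') (Get ''Y'' (V ''l'')))))))
          (Set ''w'' (Plus (V ''w'') (Times (entry ''l'') (Times (Get ''C'' (V ''l'')) (Get ''Y'' (V ''l'')))))))"
  have fr: "inputs s \<and> s ''Z'' 0 = Z \<and> s ''b'' 0 = int \<beta> \<and> s ''i'' 0 = int i \<and> s ''Y'' = s0 ''Y'' \<and> s ''C'' = s0 ''C''"
    if "I t s" for t s
    using that inputs_frame[OF inp, of "{''u'', ''w'', ''l''}" s] s0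
    by (simp add: I_def frame_def)
  have step: "runs ?body s (tick B + tick B) (\<lambda>s'. store_bounded B s' \<and> s' ''l'' 0 = int t \<and> I (Suc t) s')"
    if t: "t < n" and I: "I t s" and sl: "s ''l'' 0 = int t" and b: "store_bounded B s" for t s
  proof -
    have in': "s ''n'' 0 = int n" "s ''A'' (int i * int n + int t) = A i t" "s ''Y'' (int t) = v t"
      "s ''C'' (int t) = (if t < j then 0 else C t)" "s ''Z'' 0 = Z" "s ''b'' 0 = int \<beta>" "s ''i'' 0 = int i"
      using fr[OF I] t i vs cs by (auto simp: inputs_def)
    have u: "\<bar>(\<Prod>l<t. Z + int \<beta> * (A i l * v l)) * (Z + int \<beta> * (A i t * v t))\<bar> \<le> 2 ^ B"
      using U_bounds[OF i v, of "Suc t"] t U_le by simp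
    have w: "\<bar>(\<Sum>l<t. A i l * ((if l < j then 0 else C l) * v l)) + A i t * ((if t < j then 0 else C t) * v t)\<bar> \<le> 2 ^ B"
      using W_bounds[OF i v, of "Suc t" j] t B1 by simp
    show ?thesis
      using I sl b in' u w
      by (intro runs_Seq runs_Put_bounded) (simp_all add: I_def power2_eq_square)
  qed
  have loop: "runs (For ''l'' ''n'' ?body) s
      (n * ((tick B + tick B) + 2 * tick B) + 2 * tick B) (\<lambda>s'. store_bounded B s' \<and> I n s')"
    if "store_bounded B s" "I 0 s" for s
    using that
  proof (rule runs_For[where I = I])
    show "s ''n'' 0 = int n" if "I i s" for i s
      using fr[OF that] by (simp add: inputs_def)
  qed (use step in \<open>auto simp: I_def\<close>)
  show ?thesis
    unfolding row_prog_def row_time_def using B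
    by (intro runs_Seq runs_Put_bounded runs_mono[OF loop])
      (auto simp: I_def U_def W_def power2_eq_square)
qed

definition price_time :: nat where
  "price_time = m * ((row_time + tick B) + 2 * tick B) + 2 * tick B"

lemma price_runs:
  assumes B: "store_bounded B s0" and inp: "inputs s0"
    and s0: "s0 ''Z'' 0 = Z" "s0 ''b'' 0 = int \<beta>" "s0 ''j'' 0 = int j" "s0 ''q'' 0 = C j" "s0 ''H'' 0 = 0"
    and j: "j < n"
    and vs: "\<forall>l<n. s0 ''Y'' (int l) = v l" and cs: "\<forall>l<n. s0 ''C'' (int l) = (if l < Suc j then 0 else C l)"
    and v: "\<forall>l<n. 0 \<le> v l \<and> v l \<le> Z"
  shows "runs price_prog s0 price_time
    (\<lambda>s. store_bounded B s \<and> (frame {''u'', ''w'', ''l'', ''i'', ''H''} s0 s \<and> s ''H'' 0 = H j v))"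
proof -
  define I where "I t s \<longleftrightarrow> frame {''u'', ''w'', ''l'', ''i'', ''H''} s0 s \<and>
    s ''H'' 0 = (\<Sum>i<t. A i j * (U v i * (C j * Z + int \<beta> * W (Suc j) v i)))" for t s
  let ?put = "Set ''H'' (Plus (V ''H'') (Times (entry ''j'')
      (Times (V ''u'') (Plus (Times (V ''q'') (V ''Z'')) (Times (V ''b'') (V ''w''))))))"
  have fr: "inputs s \<and> s ''Z'' 0 = Z \<and> s ''b'' 0 = int \<beta> \<and> s ''j'' 0 = int j \<and> s ''q'' 0 = C j \<and>
      s ''Y'' = s0 ''Y'' \<and> s ''C'' = s0 ''C''"
    if "I t s" for t s
    using that inputs_frame[OF inp, of "{''u'', ''w'', ''l'', ''i'', ''H''}" s] s0
    by (simp add: I_def frame_def)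
  have step: "runs (Seq row_prog ?put) s (row_time + tick B) (\<lambda>s'. store_bounded B s' \<and> s' ''i'' 0 = int t \<and> I (Suc t) s')"
    if t: "t < m" and I: "I t s" and si: "s ''i'' 0 = int t" and b: "store_bounded B s" for t s
  proof (rule runs_Seq, rule runs_mono[OF _ order_refl])
    note f = fr[OF I]
    show "runs row_prog s row_time (\<lambda>s'. store_bounded B s' \<and>
        (frame {''u'', ''w'', ''l''} s s' \<and> s' ''u'' 0 = U v t \<and> s' ''w'' 0 = W (Suc j) v t))"
      by (rule row_runs) (use f b si t vs cs v in auto)
    fix s' assume s': "store_bounded B s' \<and> (frame {''u'', ''w'', ''l''} s s' \<and> s' ''u'' 0 = U v t \<and> s' ''w'' 0 = W (Suc j) v t)"
    have fr': "frame {''u'', ''w'', ''l'', ''i'', ''H''} s0 s'"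
      using I s' frame_trans[of "{''u'', ''w'', ''l'', ''i'', ''H''}" s0 s "{''u'', ''w'', ''l''}" s']
      by (simp add: I_def)
    have in': "s' ''n'' 0 = int n" "s' ''A'' (int t * int n + int j) = A t j" "s' ''Z'' 0 = Z" "s' ''b'' 0 = int \<beta>"
      "s' ''i'' 0 = int t" "s' ''j'' 0 = int j" "s' ''q'' 0 = C j"
      "s' ''H'' 0 = (\<Sum>i<t. A i j * (U v i * (C j * Z + int \<beta> * W (Suc j) v i)))"
      using f si I s' t j by (auto simp: inputs_def frame_def I_def)
    have h: "\<bar>(\<Sum>i<t. A i j * (U v i * (C j * Z + int \<beta> * W (Suc j) v i))) +
        A t j * (U v t * (C j * Z + int \<beta> * W (Suc j) v t))\<bar> \<le> 2 ^ B"
      using price_bounds[OF v, of "Suc t" j] t j by simp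
    show "runs ?put s' (tick B) (\<lambda>s'. store_bounded B s' \<and> s' ''i'' 0 = int t \<and> I (Suc t) s')"
      using s' fr' in' h by (intro runs_Put_bounded) (simp_all add: I_def power2_eq_square)
  qed
  show ?thesis
    unfolding price_prog_def price_time_def
  proof (rule runs_mono[OF runs_For[where I = I and N = m, OF B] order_refl])
    show "s ''m'' 0 = int m" if "I i s" for i s
      using fr[OF that] by (simp add: inputs_def)
  qed (use step s0 in \<open>auto simp: I_def H_def\<close>)
qed

definition column_time :: nat where
  "column_time = (tick B + (tick B + (tick B + (tick B + tick B)))) + (price_time + (tick B + (tick B + tick B)))"

text \<open>The output is described through \<open>Y (Suc l) l\<close>, the value fixed in step
  \<open>l\<close>, so that entries already written need no update when \<open>j\<close>
  advances.\<close>

definition state :: "store \<Rightarrow> nat \<Rightarrow> store \<Rightarrow> bool" where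
  "state s0 j s \<longleftrightarrow> frame {''q'', ''C'', ''Y'', ''y'', ''u'', ''w'', ''l'', ''i'', ''H'', ''j''} s0 s \<and>
    (\<forall>l<n. s ''Y'' (int l) = Y j l) \<and> (\<forall>l<n. s ''C'' (int l) = (if l < j then 0 else C l)) \<and>
    (\<forall>l<j. s ''y'' (int l) = (if Y (Suc l) l = 0 then 0 else 1))"

lemma column_runs:
  assumes inp: "inputs s0"
    and s0: "s0 ''Z'' 0 = Z" "s0 ''b'' 0 = int \<beta>" "s0 ''O'' 0 = total" "s0 ''G'' 0 = G"
    and j: "j < n" and b: "store_bounded B s" and st: "state s0 j s" and sj: "s ''j'' 0 = int j"
  shows "runs column_prog s column_time (\<lambda>s. store_bounded B s \<and> s ''j'' 0 = int j \<and> state s0 (Suc j) s)"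
proof -
  let ?W = "{''q'', ''C'', ''Y'', ''y'', ''u'', ''w'', ''l'', ''i'', ''H'', ''j''}"
  let ?v = "(Y j)(j := 0)"
  have fr: "inputs s \<and> s ''Z'' 0 = Z \<and> s ''b'' 0 = int \<beta> \<and> s ''O'' 0 = total \<and> s ''G'' 0 = G"
    if "frame ?W s0 s" for s
    using that inputs_frame[OF inp that] s0 by (simp add: frame_def)
  define Q where "Q s \<longleftrightarrow> store_bounded B s \<and> frame ?W s0 s \<and> s ''j'' 0 = int j \<and> s ''q'' 0 = C j \<and>
    (\<forall>l<n. s ''Y'' (int l) = ?v l) \<and> (\<forall>l<n. s ''C'' (int l) = (if l < Suc j then 0 else C l)) \<and>
    (\<forall>l<j. s ''y'' (int l) = (if Y (Suc l) l = 0 then 0 else 1)) \<and> s ''y'' (int j) = 0" for s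
  have v: "0 \<le> ?v l \<and> ?v l \<le> Z" if "l < n" for l using Y_range[OF that] Z_ge by auto
  have reset: "runs reset_prog s (tick B + (tick B + (tick B + (tick B + tick B)))) (\<lambda>s. Q s \<and> s ''H'' 0 = 0)"
  proof -
    have c: "\<bar>C j\<bar> \<le> 2 ^ B" using C[OF j] KZ_bounds(2) by simp
    show ?thesis unfolding reset_prog_def
      using b st sj j c
      by (intro runs_Seq runs_Put_bounded) (simp_all add: Q_def state_def power2_eq_square)
  qed
  have price: "runs price_prog s1 price_time (\<lambda>s. Q s \<and> s ''H'' 0 = H j ?v)"
    if s1: "Q s1" "s1 ''H'' 0 = 0" for s1
  proof (rule runs_mono[OF _ order_refl])
    show "runs price_prog s1 price_time
        (\<lambda>s. store_bounded B s \<and> (frame {''u'', ''w'', ''l'', ''i'', ''H''} s1 s \<and> s ''H'' 0 = H j ?v))"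
      by (rule price_runs) (use s1 fr[of s1] j v in \<open>auto simp: Q_def\<close>)
    fix s assume s: "store_bounded B s \<and> (frame {''u'', ''w'', ''l'', ''i'', ''H''} s1 s \<and> s ''H'' 0 = H j ?v)"
    have "frame ?W s0 s1" using s1 by (simp add: Q_def)
    then have "frame ?W s0 s" using s frame_trans[of ?W s0 s1 "{''u'', ''w'', ''l'', ''i'', ''H''}" s ?W] by simp
    moreover have "s ''j'' = s1 ''j'' \<and> s ''q'' = s1 ''q'' \<and> s ''Y'' = s1 ''Y'' \<and> s ''C'' = s1 ''C'' \<and> s ''y'' = s1 ''y''"
      using s by (simp add: frame_def)
    ultimately show "Q s \<and> s ''H'' 0 = H j ?v" using s s1 by (simp add: Q_def)
  qed
  have accept: "runs accept_prog s1 (tick B + (tick B + tick B)) (\<lambda>s. store_bounded B s \<and> s ''j'' 0 = int j \<and> state s0 (Suc j) s)"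
    if s1: "Q s1" "s1 ''H'' 0 = H j ?v" for s1
  proof -
    have f: "s1 ''Z'' 0 = Z" "s1 ''O'' 0 = total" "s1 ''G'' 0 = G" "store_bounded B s1" "s1 ''q'' 0 = C j"
      using fr[of s1] s1 by (auto simp: Q_def)
    let ?Q = "\<lambda>s. store_bounded B s \<and> s ''j'' 0 = int j \<and> state s0 (Suc j) s"
    let ?b = "Less (Times (V ''G'') (V ''q'')) (Times (V ''H'') (V ''O''))"
    let ?P = "Seq (Put ''Y'' (V ''j'') (V ''Z'')) (Put ''y'' (V ''j'') (Num 1))"
    have "runs Skip s1 (tick B + tick B) ?Q" if "bval ?b s1"
    proof (rule runs_Skip)
      show "?Q s1" using that f s1 by (auto simp: Q_def state_def less_Suc_eq)
    qed (simp add: tick_def)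
    moreover have "runs ?P s1 (tick B + tick B) ?Q" if "\<not> bval ?b s1"
      using that f s1 KZ_bounds(3) Z_ge
      by (intro runs_Seq runs_Put_bounded) (auto simp: Q_def state_def less_Suc_eq power2_eq_square)
    ultimately have "runs (If ?b Skip ?P) s1 (bcost ?b s1 + 1 + (tick B + tick B)) ?Q"
      by (rule runs_If)
    then show ?thesis
      unfolding accept_prog_def
      by (rule runs_mono) (use bcost_Less[OF f(4), of "Times (V ''G'') (V ''q'')" "Times (V ''H'') (V ''O'')"] in
        \<open>simp_all add: power2_eq_square\<close>)
  qed
  show ?thesis
    unfolding column_prog_def column_time_def
    by (intro runs_Seq runs_mono[OF reset] runs_mono[OF price] accept) auto
qed

definition round_time :: nat where
  "round_time = tick B + (n * (column_time + 2 * tick B) + 2 * tick B)"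

lemma round_runs:
  assumes B: "store_bounded B s0" and inp: "inputs s0"
    and s0: "s0 ''Z'' 0 = Z" "s0 ''b'' 0 = int \<beta>" "s0 ''O'' 0 = total" "s0 ''R'' 0 = 3 ^ \<beta>"
      "s0 ''P'' 0 = Z ^ n" "s0 ''K'' 0 = K" "\<forall>l<n. s0 ''C'' (int l) = C l \<and> s0 ''Y'' (int l) = X l"
  shows "runs round_prog s0 round_time
    (\<lambda>s. \<forall>l<n. s ''y'' (int l) = (if Y (Suc l) l = 0 then 0 else 1))"
proof -
  have loop: "runs (For ''j'' ''n'' column_prog) s (n * (column_time + 2 * tick B) + 2 * tick B)
      (\<lambda>s'. store_bounded B s' \<and> state s n s')"
    if s: "store_bounded B s" "frame {''G''} s0 s" "s ''G'' 0 = G" for s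
  proof (rule runs_For[where I = "state s", OF s(1)])
    have eq: "s a = s0 a" if "a \<noteq> ''G''" for a using s(2) that by (simp add: frame_def)
    have inp': "inputs s" using inputs_frame[OF inp s(2)] by simp
    show "state s 0 s" using s0 by (simp add: state_def eq)
    show "s' ''n'' 0 = int n" if "state s i s'" for i s'
      using that inp' by (simp add: state_def frame_def inputs_def)
    show "runs column_prog s' column_time (\<lambda>s'. store_bounded B s' \<and> s' ''j'' 0 = int i \<and> state s (Suc i) s')"
      if "i < n" "state s i s'" "s' ''j'' 0 = int i" "store_bounded B s'" for i s'
      by (rule column_runs) (use that inp' s0 s(3) in \<open>auto simp: eq\<close>)
  qed (auto simp: state_def)
  have G: "\<bar>2 * (3 ^ \<beta> * (int m * ((Z * Z ^ n) * (K * Z))))\<bar> \<le> 2 ^ B"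
    using B3 G_bounds(1) by (simp add: G_def)
  show ?thesis
    unfolding round_prog_def round_time_def
    using B s0 G inp
    by (intro runs_Seq runs_Put_bounded runs_mono[OF loop])
      (auto simp: power2_eq_square G_def inputs_def state_def)
qed

text \<open>The cube comes from the nesting of columns, rows and row entries. \<open>M\<close> also
  has to bound \<open>\<beta>\<close>, the number of doublings.\<close>

lemma rounding_prog_runs:
  assumes "store_bounded B s0" and "inputs s0"
    and M: "1 \<le> M" "m \<le> M" "n \<le> M" "\<beta> \<le> M"
  shows "runs rounding_prog s0 (60 * tick B * M ^ 3)
    (\<lambda>s. \<forall>l<n. s ''y'' (int l) = (if Y (Suc l) l = 0 then 0 else 1))"
proof -
  let ?Q = "\<lambda>s. \<forall>l<n. s ''y'' (int l) = (if Y (Suc l) l = 0 then 0 else 1)"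
  let ?t1 = "tick B + (tick B + (n * ((tick B + tick B) + 2 * tick B) + 2 * tick B))"
  let ?t2 = "tick B + (tick B + (tick B + (n * ((tick B + (tick B + (tick B + tick B))) + 2 * tick B) + 2 * tick B)))"
  let ?t3 = "tick B + (tick B + (tick B + (\<beta> * (tick B + 1 + (tick B + (tick B + tick B))) + (tick B + 1))))"
  have "runs rounding_prog s0 (?t1 + (?t2 + (?t3 + round_time))) ?Q"
    unfolding rounding_prog_def
  proof (rule runs_Seq, rule runs_mono[OF count_runs[OF assms(1,2)] order_refl])
    fix s1 assume "store_bounded B s1 \<and> (frame {''k'', ''K'', ''j''} s0 s1 \<and> s1 ''k'' 0 = k \<and> s1 ''K'' 0 = K)"
    then have b1: "store_bounded B s1" and i1: "inputs s1" and s1: "s1 ''k'' 0 = k" "s1 ''K'' 0 = K"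
      using inputs_frame[OF assms(2), of "{''k'', ''K'', ''j''}" s1] by auto
    show "runs (Seq scale_prog (Seq base_prog round_prog)) s1 (?t2 + (?t3 + round_time)) ?Q"
    proof (rule runs_Seq, rule runs_mono[OF scale_runs[OF b1 i1 s1] order_refl])
      fix s2 assume s2: "store_bounded B s2 \<and> (frame {''Z'', ''P'', ''O'', ''C'', ''Y'', ''j''} s1 s2 \<and> s2 ''Z'' 0 = Z \<and>
        s2 ''P'' 0 = Z ^ n \<and> s2 ''O'' 0 = total \<and> (\<forall>l<n. s2 ''C'' (int l) = C l \<and> s2 ''Y'' (int l) = X l))"
      then have b2: "store_bounded B s2" and i2: "inputs s2" and K2: "s2 ''K'' 0 = K"
        using inputs_frame[OF i1, of "{''Z'', ''P'', ''O'', ''C'', ''Y'', ''j''}" s2] s1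
        by (auto simp: frame_def)
      show "runs (Seq base_prog round_prog) s2 (?t3 + round_time) ?Q"
      proof (rule runs_Seq, rule runs_mono[OF base_runs[OF b2 i2 K2] order_refl])
        fix s3 assume s3: "store_bounded B s3 \<and> (frame {''E'', ''R'', ''b''} s2 s3 \<and> s3 ''R'' 0 = 3 ^ \<beta> \<and> s3 ''b'' 0 = int \<beta>)"
        then have "inputs s3" using inputs_frame[OF i2, of "{''E'', ''R'', ''b''}" s3] by auto
        then show "runs round_prog s3 round_time ?Q"
          by (intro round_runs) (use s2 s3 K2 in \<open>auto simp: frame_def\<close>)
      qed (use s2 in auto)
    qed
  qed
  then show ?thesis
  proof (rule runs_mono)
    define t where "t = tick B"
    have t: "1 \<le> t" by (simp add: t_def tick_def)
    have M1: "M \<le> M ^ 2" "M \<le> M ^ 3" "M ^ 2 \<le> M ^ 3" "1 \<le> M ^ 3"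
      using M(1) by (auto simp: power2_eq_square power3_eq_cube)
    have n: "n * t \<le> M ^ 3 * t" using M M1 by (intro mult_right_mono) auto
    have nm: "n * (m * t) \<le> M ^ 3 * t"
    proof -
      have "n * m \<le> M * M" using M by (intro mult_mono) auto
      then have "n * m \<le> M ^ 3" using M1 by (simp add: power2_eq_square)
      then show ?thesis by (metis mult.assoc mult_right_mono zero_le)
    qed
    have nmn: "n * (m * (n * t)) \<le> M ^ 3 * t"
    proof -
      have "n * (m * n) \<le> M * (M * M)" using M by (intro mult_mono) auto
      then have "n * (m * n) * t \<le> M ^ 3 * t" by (intro mult_right_mono) (auto simp: power3_eq_cube)
      then show ?thesis by (simp add: ac_simps)
    qed
    have b: "\<beta> * t \<le> M ^ 3 * t" using M M1 by (intro mult_right_mono) auto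
    have b': "\<beta> \<le> M ^ 3 * t" using b t by (metis le_trans mult.right_neutral mult_le_mono2)
    have o: "t \<le> M ^ 3 * t" "1 \<le> M ^ 3 * t" using M1 t by auto
    \<comment> \<open>Every term is at most \<open>M ^ 3 * t\<close>, and the coefficients add up to
      55.\<close>
    have "?t1 + (?t2 + (?t3 + round_time)) =
        16 * t + 22 * (n * t) + 1 + 4 * (\<beta> * t) + \<beta> + 7 * (n * (m * t)) + 4 * (n * (m * (n * t)))"
      unfolding round_time_def column_time_def price_time_def row_time_def t_def
      by (simp add: algebra_simps)
    also have "\<dots> \<le> 60 * (M ^ 3 * t)" using n nm nmn b b' o by linarith
    finally show "?t1 + (?t2 + (?t3 + round_time)) \<le> 60 * tick B * M ^ 3"
      by (simp add: t_def ac_simps)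
  qed
qed

lemma Y_final: "l < j \<Longrightarrow> Y j l = Y (Suc l) l"
  by (induction j) (auto simp: less_Suc_eq)

end

section \<open>Agreement of the integer computation with the rounding over the reals\<close>

context proper_machine
begin

text \<open>If the vectors agree up to the factor \<open>Z\<close>, then \<open>U\<close> is
  \<open>Z ^ n\<close> times the growth and \<open>W\<close> is \<open>K * Z\<close> times the tail.
  The two sides of the integer test are then those of the real test times one common positive
  factor, so both computations decide column \<open>j\<close> alike.\<close>

lemma Y_eq_rounding:
  fixes c z :: "nat \<Rightarrow> real"
  assumes c: "\<And>l. l < n \<Longrightarrow> real_of_int (C l) = K * c l" and z: "\<And>l. l < n \<Longrightarrow> real_of_int (X l) = Z * z l"
    and \<theta>: "\<theta> = 2 * 3 ^ \<beta> * real m * (K * Z) / total"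
    and "j \<le> n" and "l < n"
  shows "real_of_int (Y j l) = Z * rounding m n (\<lambda>i l. real_of_int (A i l)) c (real \<beta>) \<theta> z j l"
  using assms(4,5)
proof (induction j arbitrary: l)
  case 0
  then show ?case using z by simp
next
  case (Suc j)
  let ?a = "\<lambda>i l. real_of_int (A i l)"
  define v where "v = (Y j)(j := 0)"
  define r where "r = (rounding m n ?a c (real \<beta>) \<theta> z j)(j := 0)"
  have v: "real_of_int (v l) = Z * r l" if "l < n" for l
    using Suc.IH[OF _ that] Suc.prems by (simp add: v_def r_def)
  have j: "j < n" using Suc.prems by simp
  have pos: "0 < real_of_int Z" "0 < real_of_int K" "0 < real_of_int total"
    using Z_ge K_ge total_ge by auto
  have U: "real_of_int (U v i) = Z ^ n * growth n (real \<beta>) ?a r i" for i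
  proof -
    have "real_of_int (U v i) = (\<Prod>l<n. Z * (1 + real \<beta> * (?a i l * r l)))"
      unfolding U_def of_int_prod by (intro prod.cong) (auto simp: v algebra_simps)
    then show ?thesis by (simp add: growth_def prod.distrib)
  qed
  have W: "real_of_int (W (Suc j) v i) = K * Z * tail_weight n ?a c (Suc j) r i" for i
  proof -
    have "real_of_int (W (Suc j) v i) = (\<Sum>l<n. if l \<in> {Suc j..} then real_of_int K * real_of_int Z * (?a i l * c l * r l) else 0)"
      unfolding W_def of_int_sum by (intro sum.cong) (auto simp: v c)
    also have "\<dots> = (\<Sum>l\<in>{..<n} \<inter> {Suc j..}. real_of_int K * real_of_int Z * (?a i l * c l * r l))"
      by (simp add: sum.inter_restrict)
    also have "{..<n} \<inter> {Suc j..} = {Suc j..<n}" by auto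
    finally show ?thesis by (simp add: tail_weight_def sum_distrib_left)
  qed
  define h where "h = (\<Sum>i<m. ?a i j * (growth n (real \<beta>) ?a r i * (c j + real \<beta> * tail_weight n ?a c (Suc j) r i)))"
  have H: "real_of_int (H j v) = (Z ^ n * (K * Z)) * h"
    unfolding H_def h_def of_int_sum sum_distrib_left
    by (intro sum.cong) (auto simp: U W c[OF j] algebra_simps)
  have "G * C j < H j v * total \<longleftrightarrow> real_of_int (G * C j) < real_of_int (H j v * total)"
    by (simp only: of_int_less_iff)
  also have "real_of_int (G * C j) = (Z ^ n * (K * Z)) * (2 * 3 ^ \<beta> * real m * (K * Z) * c j)"
    by (simp add: G_def c[OF j] algebra_simps)
  also have "real_of_int (H j v * total) = (Z ^ n * (K * Z)) * (h * total)"
    by (simp add: H)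
  also have "(Z ^ n * (K * Z)) * (2 * 3 ^ \<beta> * real m * (K * Z) * c j) < (Z ^ n * (K * Z)) * (h * total) \<longleftrightarrow>
      2 * 3 ^ \<beta> * real m * (K * Z) * c j < h * total"
    using pos by (intro mult_less_cancel_left_pos) simp
  also have "\<dots> \<longleftrightarrow> \<theta> * c j < h"
    using pos by (simp add: \<theta> field_simps)
  finally have "G * C j < H j v * total \<longleftrightarrow> \<not> accepts m n ?a c (real \<beta>) \<theta> j r"
    by (simp add: accepts_def h_def not_le)
  then show ?case using Suc.IH[of l] Suc.prems by (simp add: v_def r_def)
qed

end

section \<open>Polynomial time\<close>

lemma le_power2_mult: "x \<le> 2 ^ p \<Longrightarrow> y \<le> 2 ^ q \<Longrightarrow> 0 \<le> y \<Longrightarrow> x * y \<le> 2 ^ (p + q)" for x y :: int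
  unfolding power_add by (intro mult_mono) auto

lemma le_power2_mono: "x \<le> 2 ^ p \<Longrightarrow> p \<le> q \<Longrightarrow> x \<le> 2 ^ q" for x :: int
  by (meson order_trans power_increasing one_le_numeral)

lemma le_power2_power: "x \<le> 2 ^ p \<Longrightarrow> 0 \<le> x \<Longrightarrow> x ^ r \<le> 2 ^ (p * r)" for x :: int
  by (metis power_mono power_mult)

lemma of_rat_quotient: "real_of_rat r = real_of_int (fst (quotient_of r)) / real_of_int (snd (quotient_of r))"
proof -
  have "r = of_int (fst (quotient_of r)) / of_int (snd (quotient_of r))"
    by (intro quotient_of_div) simp
  then have "real_of_rat r = real_of_rat (of_int (fst (quotient_of r)) / of_int (snd (quotient_of r)))"
    by (rule arg_cong)
  then show ?thesis by (simp only: of_rat_divide of_rat_of_int_eq)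
qed

context proper_machine
begin

text \<open>Bit lengths are linear in \<open>N\<close> except for products over the columns, which
  are quadratic: the exponents obtained are \<open>23 * N + 3 * N\<^sup>2\<close> for
  \<open>G\<close> and \<open>10 * N + 7 * N\<^sup>2\<close> for \<open>H\<close>. The bound on
  \<open>\<beta>\<close> follows from \<open>2 * m * K * Z \<le> 2 ^ (6 * N)\<close> and
  \<open>1 \<le> total\<close>.\<close>

lemma sizes_bounded:
  assumes N: "m \<le> N" "n \<le> N" and kN: "k \<le> int N" and KN: "K \<le> 2 ^ N"
  shows "bounded_machine m n (30 * N\<^sup>2) A cn cd xn xd" and "\<beta> \<le> 7 * N"
proof -
  have N1: "1 \<le> N" using mn N by simp
  have NN: "N \<le> N\<^sup>2" using N1 by (simp add: power2_eq_square)
  have pN: "int N \<le> 2 ^ N" using of_nat_less_two_power[of N, where 'a = int] by simp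
  have mN: "int m \<le> 2 ^ N" and nN: "int n \<le> 2 ^ N" and kN': "k \<le> 2 ^ N" using pN N kN by linarith+
  have two: "(2::int) \<le> 2 ^ N" using N1 self_le_power[of "2::int" N] by simp
  have "Z \<le> 2 ^ (N + (N + N))" unfolding Z_def
    by (intro le_power2_mult two kN' KN) (use k K_ge in auto)
  then have ZN: "Z \<le> 2 ^ (3 * N)" by (rule le_power2_mono) simp
  have "K * Z \<le> 2 ^ (N + 3 * N)" by (rule le_power2_mult[OF KN ZN]) (use Z_ge in simp)
  then have KZ: "K * Z \<le> 2 ^ (4 * N)" by (rule le_power2_mono) simp
  have KZ0: "0 \<le> K * Z" using KZ_ge by simp
  have "int n * (K * Z) \<le> 2 ^ (N + 4 * N)" by (rule le_power2_mult[OF nN KZ KZ0])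
  then have nKZ: "int n * (K * Z) \<le> 2 ^ (5 * N)" by (rule le_power2_mono) simp
  have "int m * (K * Z) \<le> 2 ^ (N + 4 * N)" by (rule le_power2_mult[OF mN KZ KZ0])
  then have mKZ: "int m * (K * Z) \<le> 2 ^ (5 * N)" by (rule le_power2_mono) simp
  have mKZ0: "0 \<le> int m * (K * Z)" using KZ0 by simp
  have "2 * (int m * (K * Z)) < 2 ^ (7 * N) * total"
  proof -
    have "2 * (int m * (K * Z)) \<le> 2 ^ (N + 5 * N)" by (rule le_power2_mult[OF two mKZ mKZ0])
    also have "(2::int) ^ (N + 5 * N) < 2 ^ (7 * N)" using N1 by (intro power_strict_increasing) auto
    also have "(2::int) ^ (7 * N) \<le> 2 ^ (7 * N) * total"
      using mult_left_mono[OF total_ge, of "2 ^ (7 * N)"] by simp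
    finally show ?thesis .
  qed
  then show bN: "\<beta> \<le> 7 * N" unfolding \<beta>_def by (rule Least_le)
  have "1 + int \<beta> \<le> 8 * 2 ^ N" using bN pN N1 by linarith
  then have "1 + int \<beta> \<le> 2 ^ (3 + N)" by (simp add: power_add)
  then have b1: "1 + int \<beta> \<le> 2 ^ (4 * N)" by (rule le_power2_mono) (use N1 in simp)
  have "(3::int) ^ \<beta> \<le> 4 ^ \<beta>" by (intro power_mono) auto
  also have "(4::int) ^ \<beta> = 2 ^ (2 * \<beta>)" by (simp add: power_mult)
  also have "(2::int) ^ (2 * \<beta>) \<le> 2 ^ (14 * N)" using bN by (intro power_increasing) auto
  finally have t: "(3::int) ^ \<beta> \<le> 2 ^ (14 * N)" .
  have Zn: "Z ^ n \<le> 2 ^ (3 * N\<^sup>2)"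
  proof -
    have "Z ^ n \<le> 2 ^ (3 * N * n)" by (rule le_power2_power[OF ZN]) (use Z_ge in simp)
    then show ?thesis by (rule le_power2_mono) (use N in \<open>simp add: power2_eq_square\<close>)
  qed
  have "G \<le> 2 ^ (N + (14 * N + (N + ((3 * N + 3 * N\<^sup>2) + 4 * N))))"
    unfolding G_def by (intro le_power2_mult two t mN ZN Zn KZ) (use Z_ge KZ0 in auto)
  then have G: "G \<le> 2 ^ (30 * N\<^sup>2)" by (rule le_power2_mono) (use NN in linarith)
  have "(Z * (1 + int \<beta>)) ^ n \<le> 2 ^ ((3 * N + 4 * N) * n)"
    by (rule le_power2_power[OF le_power2_mult[OF ZN b1]]) (use Z_ge in auto)
  then have U: "(Z * (1 + int \<beta>)) ^ n \<le> 2 ^ (7 * N\<^sup>2)"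
    by (rule le_power2_mono) (use N in \<open>simp add: power2_eq_square\<close>)
  have "K * Z \<le> int n * (K * Z)" using mn mult_right_mono[OF _ KZ0, of 1 "int n"] by simp
  then have "K * Z + int \<beta> * (int n * (K * Z)) \<le> (1 + int \<beta>) * (int n * (K * Z))"
    by (simp add: algebra_simps)
  also have "\<dots> \<le> 2 ^ (4 * N + 5 * N)" by (rule le_power2_mult[OF b1 nKZ]) (use KZ0 in simp)
  finally have s: "K * Z + int \<beta> * (int n * (K * Z)) \<le> 2 ^ (4 * N + 5 * N)" .
  have s0: "0 \<le> K * Z + int \<beta> * (int n * (K * Z))"
    by (intro add_nonneg_nonneg KZ0 mult_nonneg_nonneg) auto
  have "int m * ((Z * (1 + int \<beta>)) ^ n * (K * Z + int \<beta> * (int n * (K * Z)))) \<le> 2 ^ (N + (7 * N\<^sup>2 + (4 * N + 5 * N)))"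
    by (intro le_power2_mult[OF mN] le_power2_mult[OF U s s0] mult_nonneg_nonneg s0) (use Z_ge in auto)
  then have H: "int m * ((Z * (1 + int \<beta>)) ^ n * (K * Z + int \<beta> * (int n * (K * Z)))) \<le> 2 ^ (30 * N\<^sup>2)"
    by (rule le_power2_mono) (use NN in linarith)
  have "4 * (int m * (K * Z)) \<le> 2 ^ (2 + 5 * N)" using le_power2_mult[OF _ mKZ mKZ0, of 4 2] by simp
  then have M: "4 * (int m * (K * Z)) \<le> 2 ^ (30 * N\<^sup>2)" by (rule le_power2_mono) (use NN N1 in linarith)
  have n': "int n * (K * Z) \<le> 2 ^ (30 * N\<^sup>2)" by (rule le_power2_mono[OF nKZ]) (use NN in linarith)
  show "bounded_machine m n (30 * N\<^sup>2) A cn cd xn xd"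
    by (intro bounded_machine.intro proper_machine_axioms bounded_machine_axioms.intro n' M G H)
qed

end

section \<open>Encoding of rational inputs in the store\<close>

abbreviation "num r \<equiv> fst (quotient_of r)"
abbreviation "den r \<equiv> snd (quotient_of r)"

lemma den_pos: "1 \<le> den r"
  using quotient_of_denom_pos[of r "num r" "den r"] by simp

lemma abs_le_bits: "\<bar>z\<bar> \<le> 2 ^ bits z"
proof -
  have "(2::int) ^ (bits z - 1) \<le> 2 ^ bits z" by (intro power_increasing) auto
  then show ?thesis using abs_less_bits[of z] by linarith
qed

lemma rat_bits_le: "l < n \<Longrightarrow> rat_bits (c l) + rat_bits (x l) \<le> input_size m n c x"
  unfolding input_size_def
  using member_le_sum[of l "{..<n}" "\<lambda>l. rat_bits (c l) + rat_bits (x l)"] by simp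

text \<open>The summand \<open>m * n\<close> of the input size bounds both dimensions, the bit
  counts bound the numerators and denominators, and matrix entries are at most 1.\<close>

lemma input_store_bounded:
  assumes A: "\<forall>i<m. \<forall>l<n. A i l = 0 \<or> A i l = 1" and mn: "1 \<le> m" "1 \<le> n"
    and B: "input_size m n c x \<le> B"
  shows "store_bounded B (input_store m n A c x)"
  unfolding store_bounded_def
proof (intro allI)
  fix a i
  have N: "m \<le> m * n" "n \<le> m * n" using mn by auto
  have mnB: "m * n \<le> B" using B by (simp add: input_size_def)
  have "int (m * n) \<le> 2 ^ (m * n)" using of_nat_less_two_power[of "m * n", where 'a = int] by simp
  also have "(2::int) ^ (m * n) \<le> 2 ^ B" using mnB by (intro power_increasing) auto
  finally have "int (m * n) \<le> 2 ^ B" .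
  then have m: "int m \<le> 2 ^ B" and n: "int n \<le> 2 ^ B" using N by linarith+
  have entry: "\<bar>A (nat i div n) (nat i mod n)\<bar> \<le> 2 ^ B" if "0 \<le> i" "i < int (m * n)"
  proof -
    have "nat i < m * n" using that by (simp add: nat_less_iff)
    then have "nat i div n < m" by (simp add: less_mult_imp_div_less)
    moreover have "nat i mod n < n" using mn by simp
    ultimately have "\<bar>A (nat i div n) (nat i mod n)\<bar> \<le> 1" using A by force
    also have "(1::int) \<le> 2 ^ B" by simp
    finally show ?thesis .
  qed
  have z: "\<bar>z\<bar> \<le> 2 ^ B" if "bits z \<le> B" for z
    using abs_le_bits[of z] that by (meson order_trans power_increasing one_le_numeral)
  have r: "bits (num (c l)) \<le> B" "bits (den (c l)) \<le> B" "bits (num (x l)) \<le> B" "bits (den (x l)) \<le> B"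
    if "l < n" for l
    using rat_bits_le[OF that, of c x m] B by (auto simp: rat_bits_def)
  have l: "nat i < n" if "i < int n" using that mn by linarith
  show "\<bar>input_store m n A c x a i\<bar> \<le> 2 ^ B"
    unfolding input_store_def using m n entry z r l by auto
qed

lemma input_store_inputs:
  "machine.inputs m n A (\<lambda>l. num (c l)) (\<lambda>l. den (c l)) (\<lambda>l. num (x l)) (\<lambda>l. den (x l))
     (input_store m n A c x)"
proof -
  have "nat (int i * int n + int l) = i * n + l \<and> int i * int n + int l < int m * int n"
    if "i < m" "l < n" for i l
  proof -
    have "i * n + l < Suc i * n" using that by simp
    also have "\<dots> \<le> m * n" using that by (intro mult_right_mono) auto
    finally have "int (i * n + l) < int (m * n)" by (simp only: of_nat_less_iff)
    moreover have "nat (int (i * n + l)) = i * n + l" by (rule nat_int)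
    ultimately show ?thesis by simp
  qed
  then show ?thesis unfolding machine.inputs_def by (simp add: input_store_def)
qed

section \<open>Correctness and running time on rational instances\<close>

locale rational_instance =
  fixes m n k :: nat and p :: real and A :: "nat \<Rightarrow> nat \<Rightarrow> int" and c x :: "nat \<Rightarrow> rat"
  assumes inst: "instance_data m n k p A (\<lambda>j. of_rat (c j)) (\<lambda>j. of_rat (x j))"
begin

sublocale instance_data m n k p A "\<lambda>j. of_rat (c j)" "\<lambda>j. of_rat (x j)"
  by (rule inst)

sublocale mach: machine m n B A "\<lambda>l. num (c l)" "\<lambda>l. den (c l)" "\<lambda>l. num (x l)" "\<lambda>l. den (x l)" for B .

lemma mach_k: "mach.k = int k"
  using A m by (simp add: mach.k_def zero_one_matrix_def)

lemma mach_K_pos: "1 \<le> mach.K"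
  unfolding mach.K_def using den_pos by (intro prod_ge_1) (simp add: one_le_mult_int)

lemma den_dvd: "l < n \<Longrightarrow> den (c l) * (mach.K div den (c l)) = mach.K"
  and den_dvd': "l < n \<Longrightarrow> den (x l) * (mach.K div den (x l)) = mach.K"
proof -
  assume l: "l < n"
  have "den (c l) * den (x l) dvd mach.K" unfolding mach.K_def using l by (intro dvd_prodI) auto
  then have "den (c l) dvd mach.K" "den (x l) dvd mach.K"
    by (metis dvd_mult_left, metis dvd_mult_right)
  then show "den (c l) * (mach.K div den (c l)) = mach.K" "den (x l) * (mach.K div den (x l)) = mach.K"
    by auto
qed

lemma mach_C: "l < n \<Longrightarrow> real_of_int (mach.C l) = mach.K * of_rat (c l)"
proof -
  assume l: "l < n"
  have "real_of_int (den (c l)) * real_of_int (mach.K div den (c l)) = mach.K"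
    using arg_cong[OF den_dvd[OF l], of real_of_int] by simp
  moreover have "0 < real_of_int (den (c l))" using den_pos[of "c l"] by linarith
  ultimately have "real_of_int (mach.K div den (c l)) = mach.K / den (c l)" by (simp add: field_simps)
  then show ?thesis by (simp add: mach.C_def of_rat_quotient)
qed

lemma mach_X: "l < n \<Longrightarrow> real_of_int (mach.X l) = mach.Z * z l"
proof -
  assume l: "l < n"
  have "real_of_int (den (x l)) * real_of_int (mach.K div den (x l)) = mach.K"
    using arg_cong[OF den_dvd'[OF l], of real_of_int] by simp
  moreover have d: "0 < real_of_int (den (x l))" using den_pos[of "x l"] by linarith
  ultimately have "real_of_int (mach.K div den (x l)) = mach.K / den (x l)" by (simp add: field_simps)
  then show ?thesis using d k
    by (simp add: mach.X_def mach.Z_def mach_k mixed_def of_rat_quotient field_simps)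
qed

text \<open>\<open>C l\<close> and \<open>X l\<close> are integers that equal positive reals, hence
  at least 1. Their upper bounds are the scaled forms of \<open>c l \<le> 1\<close> and
  \<open>z l \<le> 1\<close>.\<close>

lemma mach_proper: "proper_machine m n A (\<lambda>l. num (c l)) (\<lambda>l. den (c l)) (\<lambda>l. num (x l)) (\<lambda>l. den (x l))"
proof
  show "1 \<le> m" "1 \<le> n" using m k by auto
  show "A i l = 0 \<or> A i l = 1" if "i < m" "l < n" for i l
    using A that by (auto simp: zero_one_matrix_def)
  show "1 \<le> den (c l)" "1 \<le> den (x l)" for l by (rule den_pos)+
  show "1 \<le> mach.k" using k by (simp add: mach_k)
  have Z: "0 < mach.Z" using mach_K_pos k by (simp add: mach.Z_def mach_k)
  show "1 \<le> mach.C l" "mach.C l \<le> mach.K" if l: "l < n" for l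
  proof -
    note c = weightsD[OF weights p l]
    have "0 < real_of_int (mach.C l)" unfolding mach_C[OF l] using c mach_K_pos by simp
    then show "1 \<le> mach.C l" by simp
    have "real_of_int (mach.C l) \<le> mach.K" unfolding mach_C[OF l] using c mach_K_pos
      by (simp add: mult_left_le)
    then show "mach.C l \<le> mach.K" by simp
  qed
  show "1 \<le> mach.X l" "mach.X l \<le> mach.Z" if l: "l < n" for l
  proof -
    note r = z_range[OF l]
    have "0 < real_of_int (mach.X l)" unfolding mach_X[OF l] using r Z by simp
    then show "1 \<le> mach.X l" by simp
    have "real_of_int (mach.X l) \<le> mach.Z" unfolding mach_X[OF l] using r Z
      by (simp add: mult_left_le)
    then show "mach.X l \<le> mach.Z" by simp
  qed
qed

lemma objective_total: "objective n (\<lambda>j. of_rat (c j)) z = mach.total / (mach.K * mach.Z)"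
proof -
  interpret proper_machine m n _ A "\<lambda>l. num (c l)" "\<lambda>l. den (c l)" "\<lambda>l. num (x l)" "\<lambda>l. den (x l)"
    by (rule mach_proper)
  have "real_of_int mach.total = (\<Sum>l<n. mach.K * mach.Z * (of_rat (c l) * z l))"
    unfolding mach.total_def of_int_sum by (intro sum.cong) (auto simp: mach_C mach_X)
  then have "real_of_int mach.total = (mach.K * mach.Z) * objective n (\<lambda>j. of_rat (c j)) z"
    by (simp add: objective_def sum_distrib_left)
  moreover have "real_of_int (mach.K * mach.Z) \<noteq> 0" using KZ_ge by linarith
  ultimately show ?thesis by (simp only: nonzero_eq_divide_eq) (simp add: mult.commute)
qed

text \<open>A product of denominators needs no more bits than its factors together, so the common
  denominator stays linear in bit length.\<close>

lemma mach_K_le: "mach.K \<le> 2 ^ input_size m n c x"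
proof -
  have d: "0 \<le> den r" "den r \<le> 2 ^ bits (den r)" for r
    using den_pos[of r] abs_le_bits[of "den r"] by auto
  have "mach.K \<le> (\<Prod>l<n. 2 ^ bits (den (c l)) * 2 ^ bits (den (x l)))"
    unfolding mach.K_def using d by (intro prod_mono conjI mult_mono mult_nonneg_nonneg) auto
  also have "\<dots> = 2 ^ (\<Sum>l<n. bits (den (c l)) + bits (den (x l)))"
    by (simp add: power_sum power_add prod.distrib)
  also have "(\<Sum>l<n. bits (den (c l)) + bits (den (x l))) \<le> (\<Sum>l<n. rat_bits (c l) + rat_bits (x l))"
    by (intro sum_mono) (simp add: rat_bits_def)
  then have "(2::int) ^ (\<Sum>l<n. bits (den (c l)) + bits (den (x l))) \<le> 2 ^ input_size m n c x"
    by (intro power_increasing) (auto simp: input_size_def)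
  finally show ?thesis .
qed

text \<open>Halting is wanted for all \<open>1 \<le> m\<close>, quality only for
  \<open>16 \<le> m\<close>; the implication inside the postcondition lets one run provide both.
  Degree 5 combines a tick of order \<open>N ^ 2\<close> with cubic loops, and the constant is 60 *
  32000 * 7 ^ 3.\<close>

lemma rounding_prog_correct:
  shows "runs rounding_prog (input_store m n A c x) (658560000 * input_size m n c x ^ 5)
    (\<lambda>s. 16 \<le> m \<longrightarrow>
      good_rounding 240 (1 / 4) m n k p A (\<lambda>j. of_rat (c j)) (\<lambda>j. of_rat (x j)) (output_vector s))"
proof -
  define N where "N = input_size m n c x"
  interpret proper: proper_machine m n "30 * N\<^sup>2" A "\<lambda>l. num (c l)" "\<lambda>l. den (c l)" "\<lambda>l. num (x l)" "\<lambda>l. den (x l)"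
    by (rule mach_proper)
  have mnN: "m \<le> N" "n \<le> N"
  proof -
    have "m * n \<le> N" by (simp add: N_def input_size_def)
    moreover have "m * 1 \<le> m * n" "1 * n \<le> m * n"
      using proper.mn by (intro mult_le_mono; simp)+
    ultimately show "m \<le> N" "n \<le> N" by linarith+
  qed
  have N1: "1 \<le> N" using mnN m by simp
  have kN: "mach.k \<le> int N" using mach_k k mnN by simp
  note sizes = proper.sizes_bounded[OF mnN kN mach_K_le[folded N_def]]
  interpret bounded_machine m n "30 * N\<^sup>2" A "\<lambda>l. num (c l)" "\<lambda>l. den (c l)" "\<lambda>l. num (x l)" "\<lambda>l. den (x l)"
    by (rule sizes(1))
  let ?b = "mach.\<beta>"
  have "N * 1 \<le> N * (30 * N)" using N1 by (intro mult_le_mono) auto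
  then have NB: "N \<le> 30 * N\<^sup>2" by (simp add: power2_eq_square)
  have "runs rounding_prog (input_store m n A c x) (60 * tick (30 * N\<^sup>2) * (7 * N) ^ 3)
      (\<lambda>s. \<forall>l<n. s ''y'' (int l) = (if mach.Y (Suc l) l = 0 then 0 else 1))"
  proof (rule rounding_prog_runs)
    show "store_bounded (30 * N\<^sup>2) (input_store m n A c x)"
      using proper.entries proper.mn NB by (intro input_store_bounded) (auto simp: N_def)
  qed (use mnN N1 sizes(2) input_store_inputs in auto)
  then show ?thesis
  proof (rule runs_mono)
    have "tick (30 * N\<^sup>2) \<le> 32000 * N\<^sup>2" using N1 by (simp add: tick_def)
    then have "60 * tick (30 * N\<^sup>2) * (7 * N) ^ 3 \<le> 60 * (32000 * N\<^sup>2) * (7 * N) ^ 3"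
      by (intro mult_right_mono mult_left_mono) auto
    also have "\<dots> = 658560000 * N ^ 5" by (simp add: power_mult_distrib flip: power_add)
    finally show "60 * tick (30 * N\<^sup>2) * (7 * N) ^ 3 \<le> 658560000 * input_size m n c x ^ 5"
      unfolding N_def .
  next
    fix s :: store
    assume s: "\<forall>l<n. s ''y'' (int l) = (if mach.Y (Suc l) l = 0 then 0 else 1)"
    have "0 < real_of_int (mach.K * mach.Z)" using proper.KZ_ge by linarith
    then have KZ: "0 < real_of_int mach.K * real_of_int mach.Z" by (simp only: of_int_mult)
    have total: "0 < real_of_int mach.total" using proper.total_ge by linarith
    have obj: "objective n (\<lambda>j. of_rat (c j)) z = mach.total / (real_of_int mach.K * real_of_int mach.Z)"
      using objective_total by simp
    have Y: "real_of_int (mach.Y n l) = mach.Z * rounded ?b l" if "l < n" for l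
    proof (rule proper.Y_eq_rounding)
      show "threshold ?b = 2 * 3 ^ ?b * real m * (mach.K * mach.Z) / mach.total"
        unfolding threshold_def obj by simp
    qed (use that mach_C mach_X in auto)
    have out: "output_vector s l = rounded ?b l" if l: "l < n" for l
    proof -
      interpret packing m n a "\<lambda>j. of_rat (c j)" z "real ?b" "threshold ?b" by (rule packing)
      have "rounded ?b l \<in> {0, 1}" using y_earlier[OF l] .
      moreover have "mach.Y (Suc l) l = mach.Y n l" using Y_final[OF l] by simp
      moreover have "0 < real_of_int mach.Z" using proper.Z_ge by linarith
      ultimately show ?thesis using s l Y[OF l] by (auto simp: output_vector_def)
    qed
    have above: "2 * real m < 2 ^ ?b * objective n (\<lambda>j. of_rat (c j)) z"
    proof -
      have "real_of_int (2 * (int m * (mach.K * mach.Z))) < real_of_int (2 ^ ?b * mach.total)"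
        using proper.base_exists by (simp only: of_int_less_iff)
      then show ?thesis unfolding obj using KZ by (simp add: pos_less_divide_eq mult.assoc)
    qed
    have below: "?b = 0 \<or> 2 ^ (?b - 1) * objective n (\<lambda>j. of_rat (c j)) z \<le> 2 * real m"
    proof (cases "?b = 0")
      case False
      then have "real_of_int (2 ^ (?b - 1) * mach.total) \<le> real_of_int (2 * (int m * (mach.K * mach.Z)))"
        using proper.base_minimal[of "?b - 1"] by (simp only: of_int_le_iff)
      then show ?thesis unfolding obj using KZ by (simp add: pos_divide_le_eq mult.assoc)
    qed simp
    show "16 \<le> m \<longrightarrow> good_rounding 240 (1 / 4) m n k p A (\<lambda>j. of_rat (c j)) (\<lambda>j. of_rat (x j)) (output_vector s)"
      using good_rounding_rounded[OF _ above below out] by blast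
  qed
qed

end

text \<open>The separate \<open>T'\<close> allows the value of the polynomial to be substituted for
  the explicit time bound.\<close>

lemma runsD:
  assumes "runs P s T Q" and "T' = T"
  shows "halts_within P s T'" and "\<exists>t s' w'. exec P s w t s' w' \<and> Q s'"
  using assms unfolding runs_def halts_within_def by blast+

text \<open>An event that contains the support has probability 1. This serves both for the matrix
  alone and for the pair of matrix and coins.\<close>

lemma prob_ge_one_minus:
  assumes "set_pmf M \<subseteq> S"
  shows "measure_pmf.prob M S \<ge> 1 - 1 / real m"
proof -
  have "measure_pmf.prob M S = 1"
    using assms by (subst measure_pmf.prob_eq_1) (auto simp: AE_measure_pmf_iff)
  then show ?thesis by simp
qed

theorem theorem2:
  shows "\<exists>(C::real) (\<delta>::real). C > 0 \<and> \<delta> > 0 \<and>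
    (\<forall>(m::nat) (n::nat) (k::nat) (p::real).
       16 \<le> m \<and> 1 \<le> k \<and> k \<le> n \<and> 0 < p \<longrightarrow>
       measure_pmf.prob (random_matrix m n k)
         {A. \<forall>c x. weights n p c \<and> fractional_solution m n A x \<longrightarrow>
               (\<exists>y. good_rounding C \<delta> m n k p A c x y)}
       \<ge> 1 - 1 / real m) \<and>
    (\<exists>(P::com) (q::nat poly).
       (\<forall>(m::nat) (n::nat) (k::nat) (p::real) A (c::nat \<Rightarrow> rat) (x::nat \<Rightarrow> rat).
          1 \<le> m \<and> 1 \<le> k \<and> k \<le> n \<and> 0 < p \<and> A \<in> set_pmf (random_matrix m n k) \<and>
          weights n p (\<lambda>j. of_rat (c j)) \<and> fractional_solution m n A (\<lambda>j. of_rat (x j)) \<longrightarrow>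
          halts_within P (input_store m n A c x) (poly q (input_size m n c x))) \<and>
       (\<forall>(m::nat) (n::nat) (k::nat) (p::real)
          (c::(nat \<Rightarrow> nat \<Rightarrow> int) \<Rightarrow> nat \<Rightarrow> rat) (x::(nat \<Rightarrow> nat \<Rightarrow> int) \<Rightarrow> nat \<Rightarrow> rat).
          16 \<le> m \<and> 1 \<le> k \<and> k \<le> n \<and> 0 < p \<and>
          (\<forall>A \<in> set_pmf (random_matrix m n k).
             weights n p (\<lambda>j. of_rat (c A j)) \<and>
             fractional_solution m n A (\<lambda>j. of_rat (x A j))) \<longrightarrow>
          measure_pmf.prob
            (bind_pmf (random_matrix m n k)
               (\<lambda>A. map_pmf (Pair A) (coin_flips (poly q (input_size m n (c A) (x A))))))
            {(A, w). \<exists>t s w'. exec P (input_store m n A (c A) (x A)) w t s w' \<and>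
               good_rounding C \<delta> m n k p A (\<lambda>j. of_rat (c A j)) (\<lambda>j. of_rat (x A j))
                 (output_vector s)}
          \<ge> 1 - 1 / real m))"
proof (rule exI[of _ 240], rule exI[of _ "1 / 4"], intro conjI allI impI)
  fix m n k :: nat and p :: real
  assume H: "16 \<le> m \<and> 1 \<le> k \<and> k \<le> n \<and> 0 < p"
  show "measure_pmf.prob (random_matrix m n k)
      {A. \<forall>c x. weights n p c \<and> fractional_solution m n A x \<longrightarrow>
        (\<exists>y. good_rounding 240 (1 / 4) m n k p A c x y)} \<ge> 1 - 1 / real m"
  proof (intro prob_ge_one_minus subsetI CollectI allI impI)
    fix A c x
    assume "A \<in> set_pmf (random_matrix m n k)" and "weights n p c \<and> fractional_solution m n A x"
    with H interpret instance_data m n k p A c x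
      by unfold_locales (auto intro: random_matrix_zero_one)
    show "\<exists>y. good_rounding 240 (1 / 4) m n k p A c x y" using ex_good_rounding H by simp
  qed
next
  let ?q = "monom 658560000 5 :: nat poly"
  have q: "poly ?q N = 658560000 * N ^ 5" for N by (simp add: poly_monom)
  have inst: "rational_instance m n k p A c x"
    if "1 \<le> m" "1 \<le> k" "k \<le> n" "0 < p" "A \<in> set_pmf (random_matrix m n k)"
      "weights n p (\<lambda>j. of_rat (c j))" "fractional_solution m n A (\<lambda>j. of_rat (x j))"
    for m n k p A and c x :: "nat \<Rightarrow> rat"
    using that by unfold_locales (auto intro: random_matrix_zero_one)
  show "\<exists>(P::com) (q::nat poly).
       (\<forall>(m::nat) (n::nat) (k::nat) (p::real) A (c::nat \<Rightarrow> rat) (x::nat \<Rightarrow> rat).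
          1 \<le> m \<and> 1 \<le> k \<and> k \<le> n \<and> 0 < p \<and> A \<in> set_pmf (random_matrix m n k) \<and>
          weights n p (\<lambda>j. of_rat (c j)) \<and> fractional_solution m n A (\<lambda>j. of_rat (x j)) \<longrightarrow>
          halts_within P (input_store m n A c x) (poly q (input_size m n c x))) \<and>
       (\<forall>(m::nat) (n::nat) (k::nat) (p::real)
          (c::(nat \<Rightarrow> nat \<Rightarrow> int) \<Rightarrow> nat \<Rightarrow> rat) (x::(nat \<Rightarrow> nat \<Rightarrow> int) \<Rightarrow> nat \<Rightarrow> rat).
          16 \<le> m \<and> 1 \<le> k \<and> k \<le> n \<and> 0 < p \<and>
          (\<forall>A \<in> set_pmf (random_matrix m n k).
             weights n p (\<lambda>j. of_rat (c A j)) \<and>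
             fractional_solution m n A (\<lambda>j. of_rat (x A j))) \<longrightarrow>
          measure_pmf.prob
            (bind_pmf (random_matrix m n k)
               (\<lambda>A. map_pmf (Pair A) (coin_flips (poly q (input_size m n (c A) (x A))))))
            {(A, w). \<exists>t s w'. exec P (input_store m n A (c A) (x A)) w t s w' \<and>
               good_rounding 240 (1 / 4) m n k p A (\<lambda>j. of_rat (c A j)) (\<lambda>j. of_rat (x A j))
                 (output_vector s)}
          \<ge> 1 - 1 / real m)"
  proof (intro exI[of _ rounding_prog] exI[of _ ?q] conjI allI impI)
    fix m n k :: nat and p :: real and A and c x :: "nat \<Rightarrow> rat"
    assume "1 \<le> m \<and> 1 \<le> k \<and> k \<le> n \<and> 0 < p \<and> A \<in> set_pmf (random_matrix m n k) \<and>
      weights n p (\<lambda>j. of_rat (c j)) \<and> fractional_solution m n A (\<lambda>j. of_rat (x j))"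
    then interpret rational_instance m n k p A c x by (intro inst) auto
    show "halts_within rounding_prog (input_store m n A c x) (poly ?q (input_size m n c x))"
      by (rule runsD(1)[OF rounding_prog_correct q])
  next
    fix m n k :: nat and p :: real and c x :: "(nat \<Rightarrow> nat \<Rightarrow> int) \<Rightarrow> nat \<Rightarrow> rat"
    assume H: "16 \<le> m \<and> 1 \<le> k \<and> k \<le> n \<and> 0 < p \<and>
      (\<forall>A \<in> set_pmf (random_matrix m n k).
        weights n p (\<lambda>j. of_rat (c A j)) \<and> fractional_solution m n A (\<lambda>j. of_rat (x A j)))"
    have "\<exists>t s w'. exec rounding_prog (input_store m n A (c A) (x A)) w t s w' \<and>
        good_rounding 240 (1 / 4) m n k p A (\<lambda>j. of_rat (c A j)) (\<lambda>j. of_rat (x A j)) (output_vector s)"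
      if "A \<in> set_pmf (random_matrix m n k)" for A w
    proof -
      from H that interpret rational_instance m n k p A "c A" "x A" by (intro inst) auto
      show ?thesis using runsD(2)[OF rounding_prog_correct refl, of w] H by simp
    qed
    then show "measure_pmf.prob
            (bind_pmf (random_matrix m n k)
               (\<lambda>A. map_pmf (Pair A) (coin_flips (poly ?q (input_size m n (c A) (x A))))))
            {(A, w). \<exists>t s w'. exec rounding_prog (input_store m n A (c A) (x A)) w t s w' \<and>
               good_rounding 240 (1 / 4) m n k p A (\<lambda>j. of_rat (c A j)) (\<lambda>j. of_rat (x A j))
                 (output_vector s)}
          \<ge> 1 - 1 / real m"
      by (intro prob_ge_one_minus) auto
  qed
qed auto

end
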